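(* Let $(\Omega,\mathcal F,(\mathcal F_n)_{n\ge0},\mathbb P)$ be a filtered probability space with associated collection $\mathcal E$, let $1<p\leq2$, and suppose $\llbracket\mathcal E\rrbracket=\infty$. Let $X$ be a Banach space. If there exists $T_p>0$ such that for every $f\in L^p(\Omega,X)$ $$\|f\|_{L^p(\Omega,X)}\leq T_p\Big(\|\mathbb E(f|\mathcal F_0)\|_{L^p(\Omega,X)}^p+\sum_{n=1}^{\infty}\|\mathbb E(f|\mathcal F_n)-\mathbb E(f|\mathcal F_{n-1})\|_{L^p(\Omega,X)}^p\Big)^{1/p},$$ then $X$ is of Haar type $p$. Moreover $$HT_p(X)\leq 4^{\frac2p-1}\,T_p .$$
   Context: A filtered probability space $(\Omega,\mathcal F,(\mathcal F_n)_{n\ge0},\mathbb P)$: $(\mathcal F_n)_{n\ge0}$ is an increasing sequence of sub-$\sigma$-algebras with $\mathcal F=\sigma(\bigcup_n\mathcal F_n)$, and each $\mathcal F_n$ is generated by a finite partition $\mathcal A_n$ of $\Omega$ into sets of positive probability (atoms), with $\mathcal A_0=\{\Omega\}$. $L^p(\Omega,X)$ is the Bochner space of $p$-integrable $X$-valued functions. Collection $\mathcal E$: for $A\in\mathcal A_n$ write $A=\bigcup_{j=1}^{N(A)}A_j$ with $A_j\in\mathcal A_{n+1}$ pairwise disjoint, ordered so that $\mathbb P(A_j)\ge\mathbb P(A_{j+1})>0$ (one such ordering is fixed), and put $A^{\diamond}=A_1$. Put $\mathcal C_0=\emptyset$, $\mathcal E_0=\mathcal A_0$, and for $n\ge0$,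 $\mathcal C_{n+1}=\{A^\diamond:A\in\mathcal A_n\}$, $\mathcal E_{n+1}=\mathcal A_{n+1}\setminus\mathcal C_{n+1}$; $\mathcal E=\bigcup_{n\ge0}\mathcal E_n$. Carleson constant: $\llbracket\mathcal R\rrbracket=\sup_{I\in\mathcal R}\frac1{\mathbb P(I)}\sum_{J\in\mathcal R,\,J\subseteq I}\mathbb P(J)$ for a collection $\mathcal R$ of measurable sets of positive probability. Haar type: let $\mathcal I$ be the set of dyadic intervals $[\frac{k}{2^n},\frac{k+1}{2^n})$, $n\ge0$, $0\le k<2^n$. For $I\in\mathcal I$ let $I^+$ and $I^-$ be its left and right halves and $h_I=\mathbf 1_{I^+}-\mathbf 1_{I^-}$. $X$ is of Haar type $p$ if there is $C<\infty$ such that for every $\{x_I\}_{I\in\mathcal I}\subseteq X$ for which $\sum_{I\in\mathcal I}x_Ih_I$ converges in $L^p([0,1),X)$, $$\Big\|\sum_{I\in\mathcal I}x_Ih_I\Big\|_{L^p([0,1),X)}\le C\Big(\sum_{I\in\mathcal I}\|x_I\|_X^p|I|\Big)^{1/p};$$ $HT_p(X)$ is the smallest such $C$. *)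

theory Defs
  imports "HOL-Probability.Probability"
begin

subsection \<open>Bochner spaces\<close>

text \<open>
  The Bochner integral of the library is confined to second-countable value spaces.  The notions
  below are its verbatim analogues for an arbitrary, possibly non-separable, Banach space, with
  Borel measurability replaced by strong measurability.
\<close>

definition strongly_measurable :: "'a measure \<Rightarrow> ('a \<Rightarrow> 'b::banach) \<Rightarrow> bool" where
  "strongly_measurable M f \<longleftrightarrow>
     (\<exists>s. (\<forall>i. simple_function M (s i)) \<and> (\<forall>\<omega>\<in>space M. (\<lambda>i. s i \<omega>) \<longlonglongrightarrow> f \<omega>))"

definition has_bochner_int :: "'a measure \<Rightarrow> ('a \<Rightarrow> 'b::banach) \<Rightarrow> 'b \<Rightarrow> bool" where
  "has_bochner_int M f v \<longleftrightarrow> strongly_measurable M f \<and>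
     (\<exists>s. (\<forall>i. Bochner_Integration.simple_bochner_integrable M (s i)) \<and>
          (\<lambda>i. \<integral>\<^sup>+\<omega>. ennreal (norm (f \<omega> - s i \<omega>)) \<partial>M) \<longlonglongrightarrow> 0 \<and>
          (\<lambda>i. Bochner_Integration.simple_bochner_integral M (s i)) \<longlonglongrightarrow> v)"

definition bochner_integrable :: "'a measure \<Rightarrow> ('a \<Rightarrow> 'b::banach) \<Rightarrow> bool" where
  "bochner_integrable M f \<longleftrightarrow> (\<exists>v. has_bochner_int M f v)"

definition bochner_int :: "'a measure \<Rightarrow> ('a \<Rightarrow> 'b::banach) \<Rightarrow> 'b" where
  "bochner_int M f =
     (if bochner_integrable M f then THE v. has_bochner_int M f v else 0)"

text \<open>Real powers with positive exponent on the extended half-line, so that \<open>\<infinity>\<close> is mapped to \<open>\<infinity>\<close>.\<close>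

definition enn_powr :: "ennreal \<Rightarrow> real \<Rightarrow> ennreal" where
  "enn_powr x a = (if x = \<top> then \<top> else ennreal (enn2real x powr a))"

definition Lp_norm :: "real \<Rightarrow> 'a measure \<Rightarrow> ('a \<Rightarrow> 'b::banach) \<Rightarrow> ennreal" where
  "Lp_norm p M f = enn_powr (\<integral>\<^sup>+\<omega>. ennreal (norm (f \<omega>) powr p) \<partial>M) (1 / p)"

text \<open>
  Functions instead of equivalence classes modulo null sets; every class of strongly measurable
  functions in the almost-everywhere sense has a representative of the kind used here.
\<close>

definition Lp_space :: "real \<Rightarrow> 'a measure \<Rightarrow> ('a \<Rightarrow> 'b::banach) set" where
  "Lp_space p M = {f. strongly_measurable M f \<and> Lp_norm p M f < \<top>}"

text \<open>Only the sets of \<open>G\<close> matter; all integrals are taken with respect to \<open>M\<close>.\<close>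

definition has_cond_exp ::
    "'a measure \<Rightarrow> 'a measure \<Rightarrow> ('a \<Rightarrow> 'b::banach) \<Rightarrow> ('a \<Rightarrow> 'b) \<Rightarrow> bool" where
  "has_cond_exp M G f g \<longleftrightarrow>
     strongly_measurable G g \<and> bochner_integrable M f \<and> bochner_integrable M g \<and>
     (\<forall>A\<in>sets G. bochner_int M (\<lambda>\<omega>. indicator A \<omega> *\<^sub>R g \<omega>) =
                 bochner_int M (\<lambda>\<omega>. indicator A \<omega> *\<^sub>R f \<omega>))"

text \<open>A version of the conditional expectation, which is unique up to null sets.\<close>

definition cond_exp :: "'a measure \<Rightarrow> 'a measure \<Rightarrow> ('a \<Rightarrow> 'b::banach) \<Rightarrow> 'a \<Rightarrow> 'b" where
  "cond_exp M G f =
     (if \<exists>g. has_cond_exp M G f g then SOME g. has_cond_exp M G f g else (\<lambda>_. 0))"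


subsection \<open>Filtrations generated by finite partitions\<close>

text \<open>
  \<open>At n\<close> is the partition into atoms generating \<open>F n\<close>, and \<open>ch n A\<close> is the fixed enumeration
  \<open>A\<^sub>1, \<dots>, A\<^sub>N\<close>, by non-increasing probability, of the atoms of level \<open>n + 1\<close> contained in
  \<open>A \<in> At n\<close>.  It takes the level as an argument, since a set may be an atom of several levels.
\<close>

locale atomic_filtration = prob_space M + filtration "space M" F
  for M :: "'a measure" and F :: "nat \<Rightarrow> 'a measure" +
  fixes At :: "nat \<Rightarrow> 'a set set"
    and ch :: "nat \<Rightarrow> 'a set \<Rightarrow> 'a set list"
  assumes sets_M: "sets M = sigma_sets (space M) (\<Union>n. sets (F n))"
    and sets_F: "sets (F n) = sigma_sets (space M) (At n)"
    and finite_At: "finite (At n)"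
    and partition_At: "partition_on (space M) (At n)"
    and prob_At: "A \<in> At n \<Longrightarrow> 0 < prob A"
    and At_0: "At 0 = {space M}"
    and set_ch: "A \<in> At n \<Longrightarrow> set (ch n A) = {B \<in> At (Suc n). B \<subseteq> A}"
    and distinct_ch: "A \<in> At n \<Longrightarrow> distinct (ch n A)"
    and sorted_ch: "A \<in> At n \<Longrightarrow> sorted_wrt (\<lambda>B B'. prob B \<ge> prob B') (ch n A)"

definition diamond :: "(nat \<Rightarrow> 'a set \<Rightarrow> 'a set list) \<Rightarrow> nat \<Rightarrow> 'a set \<Rightarrow> 'a set" where
  "diamond ch n A = hd (ch n A)"

fun coll_C ::
    "(nat \<Rightarrow> 'a set set) \<Rightarrow> (nat \<Rightarrow> 'a set \<Rightarrow> 'a set list) \<Rightarrow> nat \<Rightarrow> 'a set set" where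
  "coll_C At ch 0 = {}"
| "coll_C At ch (Suc n) = diamond ch n ` At n"

definition coll_E ::
    "(nat \<Rightarrow> 'a set set) \<Rightarrow> (nat \<Rightarrow> 'a set \<Rightarrow> 'a set list) \<Rightarrow> 'a set set" where
  "coll_E At ch = (\<Union>n. At n - coll_C At ch n)"

definition carleson_constant :: "'a measure \<Rightarrow> 'a set set \<Rightarrow> ennreal" where
  "carleson_constant M R =
     (SUP I\<in>R. (\<Sum>\<^sub>\<infinity>J\<in>{J \<in> R. J \<subseteq> I}. emeasure M J) / emeasure M I)"


subsection \<open>Haar type\<close>

definition dyadic_intervals :: "real set set" where
  "dyadic_intervals = {{real k / 2 ^ n ..< (real k + 1) / 2 ^ n} |n k. k < (2::nat) ^ n}"

definition left_half :: "real set \<Rightarrow> real set" where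
  "left_half I = {Inf I ..< (Inf I + Sup I) / 2}"

definition right_half :: "real set \<Rightarrow> real set" where
  "right_half I = {(Inf I + Sup I) / 2 ..< Sup I}"

definition haar :: "real set \<Rightarrow> real \<Rightarrow> real" where
  "haar I t = indicator (left_half I) t - indicator (right_half I) t"

abbreviation unit_measure :: "real measure" where
  "unit_measure \<equiv> restrict_space lborel {0..<1}"

text \<open>
  The Haar series with coefficients \<open>x\<close> converges to \<open>f\<close> in \<open>L\<^sup>p\<close>, with respect to some enumeration
  of the dyadic intervals.  This covers both the lexicographic order and unconditional convergence,
  so that Haar type below is required for the largest class of convergent series.
\<close>

definition haar_sums :: "real \<Rightarrow> (real set \<Rightarrow> 'b::banach) \<Rightarrow> (real \<Rightarrow> 'b) \<Rightarrow> bool" where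
  "haar_sums p x f \<longleftrightarrow> f \<in> Lp_space p unit_measure \<and>
     (\<exists>e. bij_betw e (UNIV :: nat set) dyadic_intervals \<and>
          (\<lambda>N. Lp_norm p unit_measure (\<lambda>t. f t - (\<Sum>i<N. haar (e i) t *\<^sub>R x (e i)))) \<longlonglongrightarrow> 0)"

definition haar_type_bound :: "real \<Rightarrow> ennreal \<Rightarrow> 'b::banach itself \<Rightarrow> bool" where
  "haar_type_bound p C X \<longleftrightarrow>
     (\<forall>(x :: real set \<Rightarrow> 'b) f. haar_sums p x f \<longrightarrow>
        Lp_norm p unit_measure f \<le>
          C * enn_powr (\<Sum>\<^sub>\<infinity>I\<in>dyadic_intervals. ennreal (norm (x I) powr p * measure lborel I)) (1 / p))"

definition haar_type :: "real \<Rightarrow> 'b::banach itself \<Rightarrow> bool" where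
  "haar_type p X \<longleftrightarrow> (\<exists>C<\<top>. haar_type_bound p C X)"

text \<open>The infimum is attained, hence it is the smallest constant.\<close>

definition HT :: "real \<Rightarrow> 'b::banach itself \<Rightarrow> ennreal" where
  "HT p X = Inf {C. haar_type_bound p C X}"

end

theory Submission
  imports Defs
begin

text \<open>
  Finite Haar sums on \<open>[0,1)\<close> are reproduced, with small error, by martingales on the given
  filtration; the assumed inequality for the copies then gives the Haar type inequality.

  A Haar function \<open>h\<^sub>I\<close> is copied by a martingale started at \<open>0\<close> on an atom and run until its value
  is \<open>\<plusminus>1\<close>.  In one step the value \<open>v \<in> (-1,1)\<close> on an atom \<open>A\<close> is replaced by values \<open>w\<close> on the
  children of \<open>A\<close>, with mean \<open>v\<close> and with at most one child on which \<open>\<bar>w\<bar> < 1\<close>.  Either the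
  exceptional child is the largest one, \<open>A\<^sup>\<diamond>\<close>, and all the others receive the same sign, opposite
  to that of \<open>v\<close>; or it has at most half the measure of \<open>A\<close>.  In the first case the
  jumps \<open>d = w - v\<close> in the chosen direction are at least \<open>1\<close>, whence \<open>E\<bar>d\<bar> \<le> 2 E d\<^sup>2\<close>; in the second
  case \<open>E\<bar>d\<bar>\<close> is at most twice the measure on which the copy becomes final.  Summed over
  all steps this gives \<open>E\<Sum>d\<^sup>2 \<le> 1\<close> and \<open>E\<Sum>\<bar>d\<bar> \<le> 4\<close>, and interpolation between the two yields
  \<open>E\<Sum>\<bar>d\<bar>\<^sup>p \<le> 4\<^bsup>2-p\<^esup>\<close> (relative to the measure of the set carrying the copy), which is the \<open>p\<close>-th
  power of the constant in the claim.  Lemma \<open>splitting_exists\<close> packs this into a single inequality for a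
  potential that grows from \<open>0\<close> to \<open>1\<close> while a Haar function is being copied.

  Whenever a copy has reached \<open>\<plusminus>1\<close> on an atom, the copy of the next Haar function starts there, so
  every atom carries a state: a dyadic interval together with a value in \<open>(-1,1)\<close>.  Every dyadic
  martingale becomes a martingale along the states (\<open>interpolate_inner_sum\<close>), so the final states are
  equidistributed over the intervals of length \<open>2\<^bsup>-L\<^esup>\<close>, up to the mass of the atoms that have not got
  that far.

  This mass is small if most paths of atoms contain many atoms of \<open>\<E>\<close>.  Leaving an atom along a
  child other than \<open>A\<^sup>\<diamond>\<close>, which is a member of \<open>\<E>\<close>, either finishes a Haar function or leads to the
  exceptional child of measure at most \<open>P(A)/2\<close>; a supermartingale turns this into geometric decay of
  the unfinished mass in the number of visits to \<open>\<E>\<close> (\<open>unfinished_le\<close>).  An atom on which most paths visit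
  \<open>\<E>\<close> as often as desired exists because the Carleson constant is infinite: otherwise the expected
  number of visits would be bounded by a restarting argument (\<open>exists_rich_atom\<close>).
\<close>

section \<open>Splitting a value among weighted children\<close>

text \<open>
  Weights are removed one by one: a weight \<open>P b\<close> gets a sign whenever the rest of the target stays
  within reach of the remaining weights.  If neither sign does, then \<open>\<bar>t - sum P K\<bar> \<le> P b\<close>, so all
  remaining weights get the value \<open>1\<close> and \<open>b\<close> is the exceptional one.
\<close>

lemma sign_filling:
  fixes P :: "'a \<Rightarrow> real"
  assumes "finite K" and "\<And>B. B \<in> K \<Longrightarrow> 0 < P B" and "\<bar>t\<bar> \<le> sum P K"
  shows "\<exists>w i. (\<forall>B\<in>K. \<bar>w B\<bar> \<le> 1) \<and> (\<Sum>B\<in>K. P B * w B) = t \<and> (\<forall>B\<in>K. B \<noteq> i \<longrightarrow> \<bar>w B\<bar> = (1::real))"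
  using assms
proof (induction K arbitrary: t rule: finite_induct)
  case empty
  then show ?case by auto
next
  case (insert b K)
  have Pb: "0 < P b" and PK: "0 \<le> sum P K"
    using insert.prems(1) by (auto intro!: sum_nonneg simp: less_imp_le)
  have t: "\<bar>t\<bar> \<le> P b + sum P K" using insert by simp
  have step: ?case if s: "\<bar>s\<bar> = 1" and le: "\<bar>t - P b * s\<bar> \<le> sum P K" for s
  proof -
    obtain w i where w: "\<forall>B\<in>K. \<bar>w B\<bar> \<le> 1" "(\<Sum>B\<in>K. P B * w B) = t - P b * s"
      "\<forall>B\<in>K. B \<noteq> i \<longrightarrow> \<bar>w B\<bar> = (1::real)"
      using insert.IH[OF _ le] insert.prems(1) by auto
    have "(\<Sum>B\<in>insert b K. P B * (w(b := s)) B) = P b * s + (\<Sum>B\<in>K. P B * w B)"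
      using insert.hyps by (simp, intro sum.cong) auto
    then have "(\<Sum>B\<in>insert b K. P B * (w(b := s)) B) = t" using w by simp
    with w s show ?thesis
      by (intro exI[of _ "w(b := s)"] exI[of _ i]) (simp del: sum.insert)
  qed
  consider "\<bar>t - P b * 1\<bar> \<le> sum P K" | "\<bar>t - P b * - 1\<bar> \<le> sum P K"
    | "\<bar>t - sum P K\<bar> \<le> P b"
    using t Pb PK by linarith
  then show ?case
  proof cases
    case 1
    then show ?thesis by (rule step[rotated]) simp
  next
    case 2
    then show ?thesis by (rule step[rotated]) simp
  next
    case 3
    define w where "w = (\<lambda>B. if B = b then (t - sum P K) / P b else 1)"
    have "(\<Sum>B\<in>insert b K. P B * w B) = P b * w b + (\<Sum>B\<in>K. P B)"
      using insert.hyps by (simp add: w_def, intro sum.cong) auto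
    then have "(\<Sum>B\<in>insert b K. P B * w B) = t" using Pb by (simp add: w_def)
    moreover have "\<bar>w b\<bar> \<le> 1" using 3 Pb by (simp add: w_def)
    ultimately show ?thesis
      by (intro exI[of _ w] exI[of _ b]) (simp add: w_def)
  qed
qed

text \<open>
  The weight \<open>d\<close> takes up the whole discrepancy if all others have value \<open>1\<close>.  When \<open>P d\<close> is too
  small for that, its value is \<open>- 1\<close> and lemma \<open>sign_filling\<close> settles the others.  The case distinction
  matters later: an exceptional element other than \<open>d\<close> is dominated by \<open>d\<close>.
\<close>

lemma sign_splitting_nonpos:
  fixes P :: "'a \<Rightarrow> real"
  assumes K: "finite K" "d \<notin> K" "0 < P d" "\<And>B. B \<in> K \<Longrightarrow> 0 < P B" and v: "- 1 < v" "v \<le> 0"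
  shows "\<exists>w i. (\<forall>B\<in>insert d K. \<bar>w B\<bar> \<le> 1) \<and> (\<Sum>B\<in>insert d K. P B * w B) = v * sum P (insert d K) \<and>
      i \<in> insert d K \<and> (\<forall>B\<in>insert d K. B \<noteq> i \<longrightarrow> \<bar>w B\<bar> = 1) \<and>
      (i = d \<longrightarrow> (\<forall>B\<in>K. w B = (1::real)))"
proof -
  define t where "t = v * sum P (insert d K)"
  have PK: "0 \<le> sum P K" using K by (auto intro!: sum_nonneg simp: less_imp_le)
  have tv: "t = v * P d + v * sum P K" using K by (simp add: t_def algebra_simps)
  have "v * P d \<le> 0" "v * sum P K \<le> 0" "- P d \<le> v * P d" "- sum P K \<le> v * sum P K"
    using v PK K(3) mult_right_mono[of "-1" v "P d"] mult_right_mono[of "-1" v "sum P K"]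
    by (auto simp: mult_nonpos_nonneg)
  then have t: "t \<le> 0" "- (P d + sum P K) \<le> t" using tv by auto
  show ?thesis
  proof (cases "- P d \<le> t - sum P K")
    case True
    define w where "w = (\<lambda>B. if B = d then (t - sum P K) / P d else 1)"
    have "(\<Sum>B\<in>insert d K. P B * w B) = P d * w d + (\<Sum>B\<in>K. P B)"
      using K by (simp add: w_def, intro sum.cong) auto
    also have "\<dots> = t" using K(3) by (simp add: w_def)
    finally show ?thesis using True t K PK
      by (intro exI[of _ w] exI[of _ d]) (auto simp: w_def t_def[symmetric] abs_le_iff divide_simps simp del: sum.insert)
  next
    case False
    then have K0: "K \<noteq> {}" using tv \<open>- P d \<le> v * P d\<close> by auto
    have "\<bar>t + P d\<bar> \<le> sum P K" using False t by auto
    then obtain w i where w: "\<forall>B\<in>K. \<bar>w B\<bar> \<le> 1" "(\<Sum>B\<in>K. P B * w B) = t + P d"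
      "\<forall>B\<in>K. B \<noteq> i \<longrightarrow> \<bar>w B\<bar> = (1::real)"
      using sign_filling[OF K(1), of P "t + P d"] K(4) by blast
    obtain i' where i': "i' \<in> K" "i \<in> K \<Longrightarrow> i' = i" using K0 by blast
    have "(\<Sum>B\<in>insert d K. P B * (w(d := -1)) B) = - P d + (\<Sum>B\<in>K. P B * w B)"
      using K by (simp, intro sum.cong) auto
    then have "(\<Sum>B\<in>insert d K. P B * (w(d := -1)) B) = t" using w by simp
    then show ?thesis using w i' K(2)
      by (intro exI[of _ "w(d := -1)"] exI[of _ i']) (auto simp: t_def[symmetric] simp del: sum.insert)
  qed
qed

text \<open>
  For \<open>\<bar>v\<bar> < 1\<close> this is \<open>(2 - p) / 2 * v\<^sup>2 + (p - 1) * v\<^sup>2\<close>, the interpolation between the bounds for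
  \<open>\<bar>d\<bar>\<close> and \<open>d\<^sup>2\<close>.  The jump to \<open>1\<close> at \<open>\<bar>v\<bar> = 1\<close> is the gain from a value that has become final.
\<close>

definition haar_potential :: "real \<Rightarrow> real \<Rightarrow> real" where
  "haar_potential p v = (if \<bar>v\<bar> < 1 then p / 2 * v\<^sup>2 else 1)"

text \<open>
  Young's inequality for \<open>y\<^bsup>p\<^esup> = 4\<^bsup>2-p\<^esup> (y/4)\<^bsup>2-p\<^esup> (y\<^sup>2)\<^bsup>p-1\<^esup>\<close>.  The factor \<open>4\<close> matches
  the bound \<open>4\<close> for the accumulated total variation of a copied Haar function.
\<close>

lemma powr_le_interpolation:
  fixes y p :: real
  assumes "0 \<le> y" "1 < p" "p \<le> 2"
  shows "y powr p \<le> 4 powr (2 - p) * ((2 - p) * (y / 4) + (p - 1) * y\<^sup>2)"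
proof (cases "y = 0")
  case False
  then have y: "0 < y" using assms by simp
  have "y powr p = 4 powr (2 - p) * ((y / 4) powr (2 - p) * (y\<^sup>2) powr (p - 1))"
  proof -
    have "(y\<^sup>2) powr (p - 1) = y powr (2 * (p - 1))"
      using y by (simp add: powr_powr flip: powr_numeral)
    then have "(y / 4) powr (2 - p) * (y\<^sup>2) powr (p - 1) = y powr (2 - p + 2 * (p - 1)) / 4 powr (2 - p)"
      using y by (simp add: powr_divide powr_add[symmetric])
    then show ?thesis by (simp add: algebra_simps)
  qed
  also have "(y / 4) powr (2 - p) * (y\<^sup>2) powr (p - 1) \<le> (2 - p) * (y / 4) + (p - 1) * y\<^sup>2"
    using Youngs_inequality_0[of "2 - p" "p - 1" "y/4" "y\<^sup>2"] assms y by simp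
  finally show ?thesis by simp
qed (use assms in auto)

lemma sign_splitting:
  fixes P :: "'a \<Rightarrow> real"
  assumes K: "finite K" "d \<notin> K" "0 < P d" "\<And>B. B \<in> K \<Longrightarrow> 0 < P B" and v: "\<bar>v\<bar> < 1"
  shows "\<exists>w i s. (\<forall>B\<in>insert d K. \<bar>w B\<bar> \<le> 1) \<and> (\<Sum>B\<in>insert d K. P B * w B) = v * sum P (insert d K) \<and>
      i \<in> insert d K \<and> (\<forall>B\<in>insert d K. B \<noteq> i \<longrightarrow> \<bar>w B\<bar> = 1) \<and> \<bar>s\<bar> = 1 \<and> s * v \<le> 0 \<and>
      (i = d \<longrightarrow> (\<forall>B\<in>K. w B = (s::real)))"
proof (cases "v \<le> 0")
  case True
  then have "- 1 < v" "v \<le> 0" using v by auto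
  from sign_splitting_nonpos[where P = P, OF K this] obtain w i where
    "\<forall>B\<in>insert d K. \<bar>w B\<bar> \<le> 1" "(\<Sum>B\<in>insert d K. P B * w B) = v * sum P (insert d K)"
    "i \<in> insert d K" "\<forall>B\<in>insert d K. B \<noteq> i \<longrightarrow> \<bar>w B\<bar> = 1" "i = d \<longrightarrow> (\<forall>B\<in>K. w B = (1::real))"
    by blast
  with True show ?thesis by (intro exI[of _ w] exI[of _ i] exI[of _ 1]) simp
next
  case False
  then have "- 1 < - v" "- v \<le> 0" using v by auto
  from sign_splitting_nonpos[where P = P, OF K this] obtain w i where
    w: "\<forall>B\<in>insert d K. \<bar>w B\<bar> \<le> 1" "(\<Sum>B\<in>insert d K. P B * w B) = - v * sum P (insert d K)"
    "i \<in> insert d K" "\<forall>B\<in>insert d K. B \<noteq> i \<longrightarrow> \<bar>w B\<bar> = 1" "i = d \<longrightarrow> (\<forall>B\<in>K. w B = (1::real))"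
    by blast
  have "(\<Sum>B\<in>insert d K. P B * - w B) = - (\<Sum>B\<in>insert d K. P B * w B)"
    by (simp add: sum_negf del: sum.insert)
  with w False show ?thesis
    by (intro exI[of _ "\<lambda>B. - w B"] exI[of _ i] exI[of _ "-1"]) (simp del: sum.insert)
qed

text \<open>
  The total variation of one step, bounded by its quadratic variation and the weight on which the
  value becomes a sign.  If \<open>d\<close> is exceptional, all jumps outside \<open>d\<close> have the same size
  \<open>1 - s * v \<ge> 1\<close>, so they are at most their squares, and the jump of \<open>d\<close> only balances them.
  Otherwise \<open>\<bar>w B - v\<bar> \<le> 1 - v * w B\<close> bounds the variation by the total weight, at least half of which
  gets a sign because \<open>P i \<le> P d\<close>.
\<close>

lemma splitting_variation:
  fixes P :: "'a \<Rightarrow> real"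
  assumes K: "finite K" "d \<notin> K" "\<And>B. B \<in> insert d K \<Longrightarrow> 0 < P B" "\<And>B. B \<in> K \<Longrightarrow> P B \<le> P d"
    and v: "\<bar>v\<bar> < 1"
    and w: "\<And>B. B \<in> insert d K \<Longrightarrow> \<bar>w B\<bar> \<le> 1"
    and mean: "(\<Sum>B\<in>insert d K. P B * w B) = v * sum P (insert d K)"
    and i: "i \<in> insert d K" "\<And>B. B \<in> insert d K \<Longrightarrow> B \<noteq> i \<Longrightarrow> \<bar>w B\<bar> = 1"
    and s: "\<bar>s\<bar> = 1" "s * v \<le> 0" "i = d \<Longrightarrow> \<forall>B\<in>K. w B = (s::real)"
  defines "C \<equiv> insert d K"
  shows "(\<Sum>B\<in>C. P B * \<bar>w B - v\<bar>) \<le>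
      2 * (\<Sum>B\<in>C. P B * (w B - v)\<^sup>2) + 2 * (sum P C - (\<Sum>B\<in>C. if \<bar>w B\<bar> < 1 then P B else 0))"
proof -
  have C: "finite C" "\<And>B. B \<in> C \<Longrightarrow> 0 \<le> P B" using K by (auto simp: C_def less_imp_le)
  have unres: "(\<Sum>B\<in>C. if \<bar>w B\<bar> < 1 then P B else 0) \<le> P i"
  proof -
    have "(\<Sum>B\<in>C. if \<bar>w B\<bar> < 1 then P B else 0) \<le> (\<Sum>B\<in>C. if B = i then P B else 0)"
      using i C(2) by (intro sum_mono) (auto simp: C_def)
    also have "\<dots> = P i" using C(1) i(1) by (simp add: C_def[symmetric])
    finally show ?thesis .
  qed
  have sq: "0 \<le> (\<Sum>B\<in>C. P B * (w B - v)\<^sup>2)" using C(2) by (auto intro!: sum_nonneg)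
  have diff: "(\<Sum>B\<in>C. P B * (w B - v)) = 0"
    using mean by (simp add: C_def[symmetric] right_diff_distrib sum_subtractf sum_distrib_left mult.commute)
  show ?thesis
  proof (cases "i = d")
    case True
    \<comment> \<open>the common size of the jumps outside \<open>d\<close>, measured in the direction \<open>s\<close>\<close>
    define a where "a = 1 - s * v"
    have a: "1 \<le> a" using s(2) by (simp add: a_def)
    have jump: "s * (w B - v) = a" if "B \<in> K" for B
    proof -
      have "w B = s" "s * s = 1" using s True that by (auto simp: abs_if split: if_splits)
      then show ?thesis by (simp add: a_def algebra_simps)
    qed
    have scaled: "P d * (s * (w d - v)) + (\<Sum>B\<in>K. P B * (s * (w B - v))) = 0"
    proof -
      have "s * (\<Sum>B\<in>C. P B * (w B - v)) = 0" using diff by simp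
      then show ?thesis using K(1,2) by (simp add: C_def sum_distrib_left algebra_simps)
    qed
    have PK: "0 \<le> sum P K" using C(2) by (auto intro!: sum_nonneg simp: C_def)
    have Kterm: "(\<Sum>B\<in>K. P B * (s * (w B - v))) = sum P K * a"
      by (simp add: jump sum_distrib_right)
    have abs_s: "\<bar>x\<bar> = \<bar>s * x\<bar>" "x\<^sup>2 = (s * x)\<^sup>2" for x
      using s(1) by (auto simp: abs_mult abs_if split: if_splits)
    have "(\<Sum>B\<in>C. P B * \<bar>w B - v\<bar>) = P d * \<bar>s * (w d - v)\<bar> + (\<Sum>B\<in>K. P B * \<bar>s * (w B - v)\<bar>)"
      using K(1,2) by (simp add: C_def abs_s(1)[of "w _ - v"])
    also have "(\<Sum>B\<in>K. P B * \<bar>s * (w B - v)\<bar>) = sum P K * a"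
      using a by (simp add: jump sum_distrib_right)
    also have "P d * \<bar>s * (w d - v)\<bar> = \<bar>P d * (s * (w d - v))\<bar>"
      using K(3)[of d] by (simp add: abs_mult)
    also have "\<dots> = sum P K * a" proof -
      have "0 \<le> sum P K * a" using PK a by simp
      then show ?thesis using scaled Kterm by linarith
    qed
    finally have 1: "(\<Sum>B\<in>C. P B * \<bar>w B - v\<bar>) = 2 * (sum P K * a)" by simp
    have "sum P K * a \<le> sum P K * a\<^sup>2"
      using a PK by (intro mult_left_mono) (auto simp: power2_eq_square)
    also have "\<dots> = (\<Sum>B\<in>K. P B * (w B - v)\<^sup>2)"
      by (simp add: abs_s(2)[of "w _ - v"] jump sum_distrib_right)
    also have "\<dots> \<le> (\<Sum>B\<in>C. P B * (w B - v)\<^sup>2)"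
      using C by (intro sum_mono2) (auto simp: C_def)
    finally have 2: "sum P K * a \<le> (\<Sum>B\<in>C. P B * (w B - v)\<^sup>2)" .
    have "P i \<le> sum P C" using i C by (intro member_le_sum) (auto simp: C_def)
    then have "0 \<le> sum P C - (\<Sum>B\<in>C. if \<bar>w B\<bar> < 1 then P B else 0)" using unres by simp
    then show ?thesis unfolding 1 using 2 by (intro add_increasing2) auto
  next
    case False
    then have iK: "i \<in> K" using i by simp
    have "(\<Sum>B\<in>C. P B * \<bar>w B - v\<bar>) \<le> (\<Sum>B\<in>C. P B * (1 - v * w B))"
    proof (intro sum_mono mult_left_mono)
      fix B assume "B \<in> C"
      then have "\<bar>w B\<bar> \<le> 1" using w by (simp add: C_def)
      then have "0 \<le> (1 - v) * (1 + w B)" "0 \<le> (1 + v) * (1 - w B)"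
        using v by (auto intro!: mult_nonneg_nonneg)
      then show "\<bar>w B - v\<bar> \<le> 1 - v * w B" by (simp add: algebra_simps abs_le_iff)
    qed (use C in auto)
    also have "\<dots> = sum P C - v * (\<Sum>B\<in>C. P B * w B)"
      by (simp add: algebra_simps sum_subtractf sum_distrib_left)
    also have "\<dots> = sum P C - v\<^sup>2 * sum P C"
      using mean by (simp add: C_def[symmetric] power2_eq_square)
    also have "\<dots> \<le> sum P C" using C(2) by (simp add: sum_nonneg)
    finally have 1: "(\<Sum>B\<in>C. P B * \<bar>w B - v\<bar>) \<le> sum P C" .
    have "P i + P d = sum P {i, d}" using False by simp
    also have "\<dots> \<le> sum P C" using C iK by (intro sum_mono2) (auto simp: C_def)
    finally have "2 * P i \<le> sum P C" using K(4)[OF iK] by simp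
    then have "sum P C \<le> 2 * (sum P C - (\<Sum>B\<in>C. if \<bar>w B\<bar> < 1 then P B else 0))"
      using unres by simp
    from order_trans[OF 1 this] show ?thesis using sq by (intro add_increasing) auto
  qed
qed

text \<open>
  A child other than \<open>d\<close> counts \<open>3/2\<close> and a child with a sign counts \<open>1/3\<close>.  The only child that may
  count more than \<open>1\<close> is therefore an exceptional \<open>i \<noteq> d\<close>; as \<open>P i \<le> P d\<close>, it is compensated by the
  other children, each of which then counts at most \<open>1/2\<close>.
\<close>

lemma splitting_weight:
  fixes P :: "'a \<Rightarrow> real"
  assumes K: "finite K" "d \<notin> K" "\<And>B. B \<in> insert d K \<Longrightarrow> 0 < P B" "\<And>B. B \<in> K \<Longrightarrow> P B \<le> P d"
    and w: "\<And>B. B \<in> insert d K \<Longrightarrow> \<bar>w B\<bar> \<le> 1"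
    and i: "i \<in> insert d K" "\<And>B. B \<in> insert d K \<Longrightarrow> B \<noteq> i \<Longrightarrow> \<bar>w B\<bar> = (1::real)"
    and s: "\<bar>s\<bar> = 1" "i = d \<Longrightarrow> \<forall>B\<in>K. w B = s"
  shows "(\<Sum>B\<in>insert d K. P B * ((if B = d then 1 else 3/2) * (if \<bar>w B\<bar> < 1 then 1 else 1/3))) \<le> sum P (insert d K)"
    (is "(\<Sum>B\<in>_. P B * ?r B) \<le> _")
proof -
  have eq: "(\<Sum>B\<in>insert d K. P B * ?r B) = P d * ?r d + (\<Sum>B\<in>K. P B * ?r B)"
    using K by simp
  show ?thesis
  proof (cases "i = d")
    case True
    have "P B * ?r B \<le> P B" if "B \<in> K" for B
      using that s True K(2) K(3)[of B] by auto
    then have "(\<Sum>B\<in>K. P B * ?r B) \<le> sum P K" by (rule sum_mono)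
    moreover have "P d * ?r d \<le> P d" using K(3)[of d] by auto
    ultimately show ?thesis unfolding eq using K(1,2) by simp
  next
    case False
    then have iK: "i \<in> K" using i by simp
    have "(\<Sum>B\<in>K. P B * ?r B) \<le> (\<Sum>B\<in>K. P B / 2 + (if B = i then P B else 0))"
    proof (rule sum_mono)
      fix B assume B: "B \<in> K"
      show "P B * ?r B \<le> P B / 2 + (if B = i then P B else 0)"
        using B K(2) K(3)[of B] i(2)[of B] by auto
    qed
    also have "\<dots> = sum P K / 2 + P i"
      using K(1) iK by (simp add: sum.distrib sum_divide_distrib)
    finally have 1: "(\<Sum>B\<in>K. P B * ?r B) \<le> sum P K / 2 + P i" .
    have 2: "P d * ?r d \<le> P d / 2" using i(2)[of d] False K(3)[of d] by auto
    have "P i \<le> sum P K" using iK K by (intro member_le_sum) (auto simp: less_imp_le)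
    then show ?thesis unfolding eq using 1 2 K(1,2) K(4)[OF iK] by simp
  qed
qed

text \<open>
  The one-step estimate that carries the proof.  The third conjunct telescopes over the steps, and one
  copied Haar function contributes at most \<open>4\<^bsup>2-p\<^esup>\<close> times the measure of its support, since
  the potential runs from \<open>0\<close> to \<open>1\<close>.  The fourth makes the unfinished part small.
\<close>

lemma splitting_exists:
  fixes P :: "'a \<Rightarrow> real"
  assumes C: "finite C" "d \<in> C" "\<And>B. B \<in> C \<Longrightarrow> 0 < P B" "\<And>B. B \<in> C \<Longrightarrow> P B \<le> P d"
    and v: "\<bar>v\<bar> < 1" and p: "1 < p" "p \<le> 2"
  shows "\<exists>w. (\<forall>B\<in>C. \<bar>w B\<bar> \<le> 1) \<and> (\<Sum>B\<in>C. P B * w B) = v * sum P C \<and>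
      (\<Sum>B\<in>C. P B * \<bar>w B - v\<bar> powr p) \<le>
        4 powr (2 - p) * ((\<Sum>B\<in>C. P B * haar_potential p (w B)) - sum P C * haar_potential p v) \<and>
      (\<Sum>B\<in>C. P B * ((if B = d then 1 else 3/2) * (if \<bar>w B\<bar> < 1 then 1 else 1/3))) \<le> sum P C"
proof -
  define K where "K = C - {d}"
  have K: "finite K" "d \<notin> K" "\<And>B. B \<in> insert d K \<Longrightarrow> 0 < P B" "\<And>B. B \<in> K \<Longrightarrow> P B \<le> P d"
    and CK: "insert d K = C" using C by (auto simp: K_def)
  obtain w i s where w: "\<And>B. B \<in> C \<Longrightarrow> \<bar>w B\<bar> \<le> 1" and mean: "(\<Sum>B\<in>C. P B * w B) = v * sum P C"
    and i: "i \<in> C" "\<And>B. B \<in> C \<Longrightarrow> B \<noteq> i \<Longrightarrow> \<bar>w B\<bar> = 1"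
    and s: "\<bar>s\<bar> = 1" "s * v \<le> 0" "i = d \<Longrightarrow> \<forall>B\<in>K. w B = (s::real)"
    using sign_splitting[where P = P, OF K(1,2) K(3)[OF insertI1] K(3)[OF insertI2] v] that
    unfolding CK by blast
  define Q where "Q = (\<Sum>B\<in>C. P B * (w B - v)\<^sup>2)"
  define R where "R = sum P C - (\<Sum>B\<in>C. if \<bar>w B\<bar> < 1 then P B else 0)"
  have var: "(\<Sum>B\<in>C. P B * \<bar>w B - v\<bar>) \<le> 2 * Q + 2 * R"
    using splitting_variation[of K d P v w i s] K v w mean i s unfolding CK Q_def R_def by blast
  have Q: "Q = (\<Sum>B\<in>C. P B * (w B)\<^sup>2) - sum P C * v\<^sup>2"
  proof -
    have "Q = (\<Sum>B\<in>C. P B * (w B)\<^sup>2 - 2 * v * (P B * w B) + P B * v\<^sup>2)"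
      unfolding Q_def by (intro sum.cong) (auto simp: power2_eq_square algebra_simps)
    also have "\<dots> = (\<Sum>B\<in>C. P B * (w B)\<^sup>2) - 2 * v * (\<Sum>B\<in>C. P B * w B) + sum P C * v\<^sup>2"
      by (simp add: sum.distrib sum_subtractf sum_distrib_left sum_distrib_right)
    finally show ?thesis unfolding mean by (simp add: power2_eq_square algebra_simps)
  qed
  have pot: "haar_potential p (w B) = (2 - p) / 2 * ((w B)\<^sup>2 + 1 - (if \<bar>w B\<bar> < 1 then 1 else 0)) + (p - 1) * (w B)\<^sup>2"
    if "B \<in> C" for B
  proof (cases "\<bar>w B\<bar> < 1")
    case False
    then have "(w B)\<^sup>2 = 1" using w[OF that] by (metis abs_square_eq_1 linorder_not_less order_antisym)
    with False show ?thesis by (simp add: haar_potential_def field_simps)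
  qed (simp add: haar_potential_def field_simps)
  have "(\<Sum>B\<in>C. P B * haar_potential p (w B)) = (\<Sum>B\<in>C. (2 - p) / 2 * (P B * (w B)\<^sup>2) +
      (2 - p) / 2 * (P B - (if \<bar>w B\<bar> < 1 then P B else 0)) + (p - 1) * (P B * (w B)\<^sup>2))"
    by (intro sum.cong) (auto simp: pot field_simps)
  also have "\<dots> = (2 - p) / 2 * (\<Sum>B\<in>C. P B * (w B)\<^sup>2) + (2 - p) / 2 * R + (p - 1) * (\<Sum>B\<in>C. P B * (w B)\<^sup>2)"
    by (simp only: sum.distrib sum_subtractf sum_distrib_left[symmetric] R_def)
  finally have pot_sum: "(\<Sum>B\<in>C. P B * haar_potential p (w B)) - sum P C * haar_potential p v =
      (2 - p) / 2 * (Q + R) + (p - 1) * Q"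
    using v by (simp add: Q haar_potential_def field_simps)
  have "(\<Sum>B\<in>C. P B * \<bar>w B - v\<bar> powr p) \<le>
      (\<Sum>B\<in>C. P B * (4 powr (2 - p) * ((2 - p) * (\<bar>w B - v\<bar> / 4) + (p - 1) * (w B - v)\<^sup>2)))"
    using C(3) p by (intro sum_mono mult_left_mono) (auto intro: powr_le_interpolation[of "\<bar>_\<bar>", simplified] less_imp_le)
  also have "\<dots> = 4 powr (2 - p) * ((2 - p) / 4 * (\<Sum>B\<in>C. P B * \<bar>w B - v\<bar>) + (p - 1) * Q)"
    unfolding Q_def by (simp add: sum_distrib_left sum.distrib[symmetric] algebra_simps)
  also have "\<dots> \<le> 4 powr (2 - p) * ((2 - p) / 4 * (2 * Q + 2 * R) + (p - 1) * Q)"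
    using var p by (intro mult_left_mono add_right_mono) auto
  also have "\<dots> = 4 powr (2 - p) * ((2 - p) / 2 * (Q + R) + (p - 1) * Q)"
    by (simp add: field_simps)
  finally have "(\<Sum>B\<in>C. P B * \<bar>w B - v\<bar> powr p) \<le>
      4 powr (2 - p) * ((\<Sum>B\<in>C. P B * haar_potential p (w B)) - sum P C * haar_potential p v)"
    unfolding pot_sum .
  moreover have "(\<Sum>B\<in>C. P B * ((if B = d then 1 else 3/2) * (if \<bar>w B\<bar> < 1 then 1 else 1/3))) \<le> sum P C"
    using splitting_weight[of K d P w i s] K w i s unfolding CK by blast
  ultimately show ?thesis using w mean by blast
qed

section \<open>Atoms of the filtration\<close>

context atomic_filtration
begin

definition children :: "nat \<Rightarrow> 'a set \<Rightarrow> 'a set set" where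
  "children n A = {B \<in> At (Suc n). B \<subseteq> A}"

lemma At_in_sets_F: "A \<in> At n \<Longrightarrow> A \<in> sets (F n)"
  by (simp add: sets_F)

lemma sets_F_in_sets: "X \<in> sets (F n) \<Longrightarrow> X \<in> sets M"
  unfolding sets_M by blast

lemma At_in_sets: "A \<in> At n \<Longrightarrow> A \<in> sets M"
  by (rule sets_F_in_sets[OF At_in_sets_F])

lemma At_nonempty: "A \<in> At n \<Longrightarrow> A \<noteq> {}"
  using partition_onD3[OF partition_At] by auto

lemma Union_At: "\<Union> (At n) = space M"
  using partition_onD1[OF partition_At] by simp

lemma At_subset: "A \<in> At n \<Longrightarrow> A \<subseteq> space M"
  using Union_At[of n] by blast

lemma At_disjoint: "A \<in> At n \<Longrightarrow> B \<in> At n \<Longrightarrow> A \<noteq> B \<Longrightarrow> A \<inter> B = {}"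
  using partition_onD2[OF partition_At, of n] by (auto simp: disjoint_def)

text \<open>
  The sets that contain or avoid a given atom form a \<open>\<sigma>\<close>-algebra containing the generating partition.
\<close>

lemma At_dichotomy:
  assumes "X \<in> sets (F n)" and A: "A \<in> At n"
  shows "A \<subseteq> X \<or> A \<inter> X = {}"
proof -
  have AS: "A \<subseteq> space M" using A Union_At by blast
  have "X \<in> sigma_sets (space M) (At n)" using assms(1) by (simp add: sets_F)
  then show ?thesis
  proof (induction rule: sigma_sets.induct)
    case (Basic a)
    then show ?case using At_disjoint[OF A] by blast
  next
    case (Compl a)
    then show ?case using AS by blast
  next
    case (Union a)
    then show ?case by blast
  qed auto
qed

lemma sets_F_decomposition: "X \<in> sets (F n) \<Longrightarrow> X = \<Union> {A \<in> At n. A \<subseteq> X}"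
proof -
  assume X: "X \<in> sets (F n)"
  have "X \<subseteq> space M" using X sets.sets_into_space space_F by blast
  then show ?thesis using At_dichotomy[OF X] Union_At by blast
qed

lemma At_dichotomy_le: "A \<in> At n \<Longrightarrow> B \<in> At m \<Longrightarrow> n \<le> m \<Longrightarrow> B \<subseteq> A \<or> B \<inter> A = {}"
  using At_dichotomy[of A m B] At_in_sets_F[of A n] sets_F_mono[of n m] by auto

lemma finite_children: "finite (children n A)"
  using finite_At by (simp add: children_def)

lemma child_At: "B \<in> children n A \<Longrightarrow> B \<in> At (Suc n)"
  and child_subset: "B \<in> children n A \<Longrightarrow> B \<subseteq> A"
  by (auto simp: children_def)

lemma Union_children: "A \<in> At n \<Longrightarrow> \<Union> (children n A) = A"
proof -
  assume "A \<in> At n"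
  then have "A \<in> sets (F (Suc n))" using sets_F_mono[of n "Suc n"] At_in_sets_F by auto
  from sets_F_decomposition[OF this] show ?thesis by (simp add: children_def)
qed

lemma children_nonempty: "A \<in> At n \<Longrightarrow> children n A \<noteq> {}"
  using Union_children[of A n] At_nonempty[of A n] by auto

definition parent :: "nat \<Rightarrow> 'a set \<Rightarrow> 'a set" where
  "parent n B = (THE A. A \<in> At n \<and> B \<subseteq> A)"

lemma parent_child:
  assumes "A \<in> At n" and "B \<in> children n A"
  shows "parent n B = A"
proof -
  have B: "B \<noteq> {}" "B \<subseteq> A" using assms At_nonempty by (auto simp: children_def)
  show ?thesis unfolding parent_def
  proof (rule the_equality)
    fix A' assume "A' \<in> At n \<and> B \<subseteq> A'"
    then show "A' = A" using At_disjoint[of A n A'] assms(1) B by blast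
  qed (use assms(1) B in blast)
qed

lemma child_of_some:
  assumes B: "B \<in> At (Suc n)"
  shows "\<exists>A\<in>At n. B \<in> children n A"
proof -
  obtain \<omega> where \<omega>: "\<omega> \<in> B" using At_nonempty[OF B] by blast
  then have "\<omega> \<in> space M" using At_subset[OF B] by blast
  then obtain A where A: "A \<in> At n" "\<omega> \<in> A" using Union_At[of n] by blast
  then have "B \<subseteq> A" using At_dichotomy_le[of A n B "Suc n"] B \<omega> by auto
  then show ?thesis using A B by (auto simp: children_def)
qed

lemma sum_At_Suc:
  fixes h :: "'a set \<Rightarrow> 'c::comm_monoid_add"
  assumes X: "X \<in> sets (F n)"
  shows "(\<Sum>B | B \<in> At (Suc n) \<and> B \<subseteq> X. h B) = (\<Sum>A | A \<in> At n \<and> A \<subseteq> X. \<Sum>B\<in>children n A. h B)"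
proof -
  have "{B \<in> At (Suc n). B \<subseteq> X} = (\<Union>A\<in>{A \<in> At n. A \<subseteq> X}. children n A)"
  proof (intro equalityI subsetI)
    fix B assume B: "B \<in> {B \<in> At (Suc n). B \<subseteq> X}"
    then obtain \<omega> where \<omega>: "\<omega> \<in> B" using At_nonempty by blast
    then obtain A where A: "A \<in> At n" "\<omega> \<in> A" "A \<subseteq> X" using sets_F_decomposition[OF X] B by blast
    then have "B \<subseteq> A" using At_dichotomy_le[of A n B "Suc n"] B \<omega> by auto
    then have "B \<in> children n A" using B by (simp add: children_def)
    with A show "B \<in> (\<Union>A\<in>{A \<in> At n. A \<subseteq> X}. children n A)" by blast
  qed (auto simp: children_def)
  moreover have "children n A \<inter> children n A' = {}" if "A \<in> At n" "A' \<in> At n" "A \<noteq> A'" for A A'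
    using parent_child[OF that(1)] parent_child[OF that(2)] that(3) by blast
  ultimately show ?thesis
    using sum.UNION_disjoint[of "{A \<in> At n. A \<subseteq> X}" "children n" h] finite_At[of n] finite_children
    by simp
qed

lemma prob_Int_eq_sum_children:
  assumes A: "A \<in> At n" and Y: "Y \<in> sets M"
  shows "prob (A \<inter> Y) = (\<Sum>B\<in>children n A. prob (B \<inter> Y))"
proof -
  have "prob (\<Union>B\<in>children n A. B \<inter> Y) = (\<Sum>B\<in>children n A. prob (B \<inter> Y))"
  proof (intro finite_measure_finite_Union finite_children)
    show "(\<lambda>B. B \<inter> Y) ` children n A \<subseteq> sets M"
      using At_in_sets[OF child_At] Y by auto
    show "disjoint_family_on (\<lambda>B. B \<inter> Y) (children n A)"
      unfolding disjoint_family_on_def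
    proof (intro ballI impI)
      fix B B' assume "B \<in> children n A" "B' \<in> children n A" "B \<noteq> B'"
      then have "B \<inter> B' = {}" using At_disjoint[OF child_At child_At] by blast
      then show "B \<inter> Y \<inter> (B' \<inter> Y) = {}" by blast
    qed
  qed
  moreover have "(\<Union>B\<in>children n A. B \<inter> Y) = A \<inter> Y" using Union_children[OF A] by auto
  ultimately show ?thesis by simp
qed

lemma prob_eq_sum_children:
  assumes "A \<in> At n"
  shows "prob A = (\<Sum>B\<in>children n A. prob B)"
proof -
  have "B \<inter> space M = B" if "B \<in> children n A" for B
    using sets.sets_into_space[OF At_in_sets[OF child_At[OF that]]] by blast
  moreover have "A \<inter> space M = A" using sets.sets_into_space[OF At_in_sets[OF assms]] by blast
  ultimately show ?thesis
    using prob_Int_eq_sum_children[OF assms sets.top] by (simp cong: sum.cong)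
qed

lemma set_ch_children: "A \<in> At n \<Longrightarrow> set (ch n A) = children n A"
  by (simp add: set_ch children_def)

lemma diamond_child: "A \<in> At n \<Longrightarrow> diamond ch n A \<in> children n A"
  using children_nonempty[of A n] set_ch_children[of A n, symmetric]
  by (auto simp: diamond_def intro: hd_in_set)

lemma prob_le_diamond:
  assumes A: "A \<in> At n" and B: "B \<in> children n A"
  shows "prob B \<le> prob (diamond ch n A)"
proof -
  obtain D l where l: "ch n A = D # l"
    using children_nonempty[OF A] unfolding set_ch_children[OF A, symmetric] by (cases "ch n A") simp_all
  then have "B = D \<or> B \<in> set l" using B set_ch_children[OF A] by auto
  then show ?thesis using sorted_ch[OF A] unfolding l by (auto simp: diamond_def l)
qed

lemma child_in_coll_C:
  assumes A: "A \<in> At n" and B: "B \<in> children n A"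
  shows "B \<in> coll_C At ch (Suc n) \<longleftrightarrow> B = diamond ch n A"
proof
  assume "B \<in> coll_C At ch (Suc n)"
  then obtain A' where A': "A' \<in> At n" "B = diamond ch n A'" by auto
  then have "B \<in> children n A'" using diamond_child[OF A'(1)] by simp
  then have "A' = A" using parent_child[OF A'(1)] parent_child[OF A B] by simp
  with A' show "B = diamond ch n A" by simp
next
  assume "B = diamond ch n A"
  then show "B \<in> coll_C At ch (Suc n)" using A by simp
qed

end

section \<open>Martingales with values on atoms\<close>

lemma enn_powr_ennreal: "0 \<le> x \<Longrightarrow> enn_powr (ennreal x) a = ennreal (x powr a)"
  by (simp add: enn_powr_def)

lemma enn_powr_inverse: "0 < p \<Longrightarrow> enn_powr (enn_powr z (1 / p)) p = z"
  by (cases z) (auto simp: enn_powr_def powr_powr)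

lemma (in finite_measure) simple_bochner_integrable_iff_simple:
  "Bochner_Integration.simple_bochner_integrable M f \<longleftrightarrow> simple_function M f"
  by (auto simp: Bochner_Integration.simple_bochner_integrable.simps)

text \<open>
  The integrals of simple approximations of a simple \<open>f\<close> converge to its elementary integral, because
  the norm of their difference is at most the \<open>L\<^sup>1\<close> distance; so the value is unique.
\<close>

lemma (in finite_measure) bochner_int_simple_function:
  fixes f :: "'a \<Rightarrow> 'b::banach"
  assumes f: "simple_function M f"
  shows "has_bochner_int M f (Bochner_Integration.simple_bochner_integral M f)"
    and "bochner_int M f = Bochner_Integration.simple_bochner_integral M f"
proof -
  let ?I = "Bochner_Integration.simple_bochner_integral M :: ('a \<Rightarrow> 'b) \<Rightarrow> 'b"
  have sm: "strongly_measurable M f"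
    unfolding strongly_measurable_def using f by (intro exI[of _ "\<lambda>_. f"]) simp
  then show has: "has_bochner_int M f (?I f)"
    unfolding has_bochner_int_def using f
    by (intro conjI exI[of _ "\<lambda>_. f"]) (auto simp: simple_bochner_integrable_iff_simple)
  have unique: "v = ?I f" if "has_bochner_int M f v" for v
  proof -
    from that obtain s where s: "\<And>i. Bochner_Integration.simple_bochner_integrable M (s i)"
      "(\<lambda>i. \<integral>\<^sup>+\<omega>. ennreal (norm (f \<omega> - s i \<omega>)) \<partial>M) \<longlonglongrightarrow> 0" "(\<lambda>i. ?I (s i)) \<longlonglongrightarrow> v"
      by (auto simp: has_bochner_int_def)
    have fi: "Bochner_Integration.simple_bochner_integrable M f"
      using f by (simp add: simple_bochner_integrable_iff_simple)
    have "ennreal (norm (?I f - ?I (s i))) \<le> (\<integral>\<^sup>+\<omega>. ennreal (norm (f \<omega> - s i \<omega>)) \<partial>M)" for i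
    proof -
      have d: "Bochner_Integration.simple_bochner_integrable M (\<lambda>\<omega>. f \<omega> - s i \<omega>)"
        using simple_bochner_integrable_compose2[OF _ fi s(1), of "(-)"] by simp
      have n: "Bochner_Integration.simple_bochner_integrable M (\<lambda>\<omega>. norm (f \<omega> - s i \<omega>))"
        using simple_bochner_integrable_compose2[OF _ fi s(1), of "\<lambda>x y. norm (x - y)"] by simp
      have "norm (?I f - ?I (s i)) \<le> Bochner_Integration.simple_bochner_integral M (\<lambda>\<omega>. norm (f \<omega> - s i \<omega>))"
        using simple_bochner_integral_norm_bound[OF d] simple_bochner_integral_diff[OF fi s(1)] by simp
      then show ?thesis
        using simple_bochner_integral_eq_nn_integral[OF n] by (metis ennreal_leI norm_ge_zero)
    qed
    then have "(\<lambda>i. ennreal (norm (?I f - ?I (s i)))) \<longlonglongrightarrow> 0"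
      by (intro tendsto_sandwich[OF _ _ tendsto_const s(2)]) auto
    then have "(\<lambda>i. norm (?I f - ?I (s i))) \<longlonglongrightarrow> 0"
      using ennreal_tendsto_0_iff[where f = "\<lambda>i. norm (?I f - ?I (s i))"] by simp
    from tendsto_diff[OF tendsto_const[of "?I f"] tendsto_norm_zero_cancel[OF this]]
    have "(\<lambda>i. ?I (s i)) \<longlonglongrightarrow> ?I f" by simp
    then show ?thesis using s(3) LIMSEQ_unique by blast
  qed
  from has show "bochner_int M f = ?I f"
    unfolding bochner_int_def bochner_integrable_def
    by (auto intro!: the_equality dest: unique)
qed

context atomic_filtration
begin

definition atom :: "nat \<Rightarrow> 'a \<Rightarrow> 'a set" where
  "atom n \<omega> = (THE A. A \<in> At n \<and> \<omega> \<in> A)"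

lemma atom_eq: "A \<in> At n \<Longrightarrow> \<omega> \<in> A \<Longrightarrow> atom n \<omega> = A"
  unfolding atom_def
proof (rule the_equality)
  fix A' assume "A \<in> At n" "\<omega> \<in> A" "A' \<in> At n \<and> \<omega> \<in> A'"
  then show "A' = A" using At_disjoint[of A n A'] by blast
qed simp

lemma atom_in: "\<omega> \<in> space M \<Longrightarrow> atom n \<omega> \<in> At n \<and> \<omega> \<in> atom n \<omega>"
proof -
  assume "\<omega> \<in> space M"
  then obtain A where "A \<in> At n" "\<omega> \<in> A" using Union_At[of n] by blast
  then show ?thesis using atom_eq[of A n \<omega>] by simp
qed

lemma atom_vimage:
  assumes A: "A \<in> At n"
  shows "{\<omega> \<in> space M. atom n \<omega> = A} = A"
proof (intro equalityI subsetI)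
  fix \<omega> assume "\<omega> \<in> {\<omega> \<in> space M. atom n \<omega> = A}"
  then show "\<omega> \<in> A" using atom_in[of \<omega> n] by auto
next
  fix \<omega> assume "\<omega> \<in> A"
  then show "\<omega> \<in> {\<omega> \<in> space M. atom n \<omega> = A}" using atom_eq[OF A] At_subset[OF A] by auto
qed

lemma atom_image: "atom n ` space M = At n"
proof (intro equalityI subsetI)
  fix A assume A: "A \<in> At n"
  then obtain \<omega> where "\<omega> \<in> A" using At_nonempty[OF A] by blast
  then have "\<omega> \<in> space M" "atom n \<omega> = A" using atom_eq[OF A] At_subset[OF A] by auto
  then show "A \<in> atom n ` space M" by blast
next
  fix A assume "A \<in> atom n ` space M"
  then show "A \<in> At n" using atom_in by auto
qed

lemma simple_function_atom_F: "simple_function (F n) (atom n)"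
  unfolding simple_function_def space_F
proof (intro conjI ballI)
  fix A assume "A \<in> atom n ` space M"
  then have "A \<in> At n" by (simp add: atom_image)
  moreover have "atom n -` {A} \<inter> space M = {\<omega> \<in> space M. atom n \<omega> = A}" by blast
  ultimately show "atom n -` {A} \<inter> space M \<in> sets (F n)"
    using atom_vimage At_in_sets_F by simp
qed (simp add: atom_image finite_At)

lemma simple_function_F_mono: "simple_function (F n) f \<Longrightarrow> n \<le> m \<Longrightarrow> simple_function (F m) f"
  using sets_F_mono[of n m] by (auto simp only: simple_function_def space_F)

lemma simple_function_F_M:
  assumes "simple_function (F n) f"
  shows "simple_function M f"
  unfolding simple_function_def
proof (intro conjI ballI)
  show "finite (f ` space M)" using simple_functionD(1)[OF assms] by (simp only: space_F)
  fix x
  show "f -` {x} \<inter> space M \<in> sets M"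
    using sets_F_in_sets[OF simple_functionD(2)[OF assms, of "{x}"]] by (simp only: space_F)
qed

lemma simple_function_of_atom: "simple_function (F n) (\<lambda>\<omega>. c (atom n \<omega>))"
  using simple_function_compose1[OF simple_function_atom_F] .

lemma simple_function_of_atom_M: "simple_function M (\<lambda>\<omega>. c (atom n \<omega>))"
  using simple_function_F_M[OF simple_function_of_atom] .

lemma nn_integral_of_atom:
  fixes h :: "'a set \<Rightarrow> real"
  assumes "\<And>A. 0 \<le> h A"
  shows "(\<integral>\<^sup>+\<omega>. ennreal (h (atom n \<omega>)) \<partial>M) = ennreal (\<Sum>A\<in>At n. prob A * h A)"
proof -
  have "(\<integral>\<^sup>+\<omega>. ennreal (h (atom n \<omega>)) \<partial>M) = (\<integral>\<^sup>+\<omega>. (\<Sum>A\<in>At n. ennreal (h A) * indicator A \<omega>) \<partial>M)"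
  proof (rule nn_integral_cong)
    fix \<omega> assume "\<omega> \<in> space M"
    then have \<omega>: "atom n \<omega> \<in> At n" "\<omega> \<in> atom n \<omega>" using atom_in[of \<omega> n] by auto
    have "(\<Sum>A\<in>At n. ennreal (h A) * indicator A \<omega>) = (\<Sum>A\<in>At n. if A = atom n \<omega> then ennreal (h A) else 0)"
    proof (rule sum.cong[OF refl])
      fix A assume "A \<in> At n"
      then show "ennreal (h A) * indicator A \<omega> = (if A = atom n \<omega> then ennreal (h A) else 0)"
        using atom_eq[of A n \<omega>] \<omega> by (cases "\<omega> \<in> A") auto
    qed
    then show "ennreal (h (atom n \<omega>)) = (\<Sum>A\<in>At n. ennreal (h A) * indicator A \<omega>)"
      using \<omega> finite_At by simp
  qed
  also have "\<dots> = (\<Sum>A\<in>At n. ennreal (h A) * emeasure M A)"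
    using At_in_sets by (subst nn_integral_sum) (auto simp: nn_integral_cmult_indicator)
  also have "\<dots> = (\<Sum>A\<in>At n. ennreal (prob A * h A))"
    by (intro sum.cong) (auto simp: emeasure_eq_measure ennreal_mult'' mult.commute)
  also have "\<dots> = ennreal (\<Sum>A\<in>At n. prob A * h A)"
    using assms by (intro sum_ennreal) auto
  finally show ?thesis .
qed

lemma Lp_norm_of_atom:
  assumes "\<And>\<omega>. \<omega> \<in> space M \<Longrightarrow> f \<omega> = c (atom n \<omega>)"
  shows "Lp_norm p M f = ennreal ((\<Sum>A\<in>At n. prob A * norm (c A) powr p) powr (1 / p))"
proof -
  have "(\<integral>\<^sup>+\<omega>. ennreal (norm (f \<omega>) powr p) \<partial>M) = (\<integral>\<^sup>+\<omega>. ennreal (norm (c (atom n \<omega>)) powr p) \<partial>M)"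
    using assms by (intro nn_integral_cong) simp
  then show ?thesis
    using nn_integral_of_atom[of "\<lambda>A. norm (c A) powr p" n]
    by (simp add: Lp_norm_def enn_powr_ennreal sum_nonneg)
qed

lemma bochner_int_of_atom:
  fixes c :: "'a set \<Rightarrow> 'b::banach"
  assumes X: "X \<in> sets (F n)"
  shows "bochner_int M (\<lambda>\<omega>. indicator X \<omega> *\<^sub>R c (atom n \<omega>)) = (\<Sum>A | A \<in> At n \<and> A \<subseteq> X. prob A *\<^sub>R c A)"
proof -
  define v where "v A = (if A \<subseteq> X then c A else 0)" for A
  have v: "indicator X \<omega> *\<^sub>R c (atom n \<omega>) = v (atom n \<omega>)" if "\<omega> \<in> space M" for \<omega>
    using At_dichotomy[OF X, of "atom n \<omega>"] atom_in[OF that, of n]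
    by (auto simp: v_def indicator_def split: if_splits)
  have s: "simple_function M (\<lambda>\<omega>. indicator X \<omega> *\<^sub>R c (atom n \<omega>))"
    using simple_function_of_atom_M[of v n] v by (subst simple_function_cong) auto
  have "bochner_int M (\<lambda>\<omega>. indicator X \<omega> *\<^sub>R c (atom n \<omega>)) =
      (\<Sum>A\<in>atom n ` space M. prob {\<omega> \<in> space M. atom n \<omega> = A} *\<^sub>R v A)"
    unfolding bochner_int_simple_function(2)[OF s]
  proof (rule simple_bochner_integral_partition)
    show "Bochner_Integration.simple_bochner_integrable M (\<lambda>\<omega>. indicator X \<omega> *\<^sub>R c (atom n \<omega>))"
      using s by (simp add: simple_bochner_integrable_iff_simple)
    show "simple_function M (atom n)" by (rule simple_function_F_M[OF simple_function_atom_F])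
    show "indicator X x *\<^sub>R c (atom n x) = indicator X y *\<^sub>R c (atom n y)"
      if "x \<in> space M" "y \<in> space M" "atom n x = atom n y" for x y
      using v[OF that(1)] v[OF that(2)] that(3) by metis
  qed (rule v)
  also have "\<dots> = (\<Sum>A\<in>At n. if A \<subseteq> X then prob A *\<^sub>R c A else 0)"
    unfolding atom_image by (intro sum.cong) (auto simp: atom_vimage v_def)
  also have "\<dots> = (\<Sum>A | A \<in> At n \<and> A \<subseteq> X. prob A *\<^sub>R c A)"
    using finite_At by (simp add: sum.inter_filter)
  finally show ?thesis .
qed

text \<open>
  Simple functions of the \<open>n\<close>-th \<open>\<sigma>\<close>-algebra are constant on its atoms, and so are their limits.
\<close>

lemma strongly_measurable_F_const_on_atom:
  assumes "strongly_measurable (F n) h" and A: "A \<in> At n" and \<omega>: "\<omega> \<in> A" "\<omega>' \<in> A"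
  shows "h \<omega> = h \<omega>'"
proof -
  have sp: "\<omega> \<in> space (F n)" "\<omega>' \<in> space (F n)"
    using \<omega> sets.sets_into_space[OF At_in_sets_F[OF A]] by auto
  from assms(1) obtain s where s: "\<And>i. simple_function (F n) (s i)"
    "\<And>\<omega>. \<omega> \<in> space (F n) \<Longrightarrow> (\<lambda>i. s i \<omega>) \<longlonglongrightarrow> h \<omega>"
    unfolding strongly_measurable_def by blast
  have "s i \<omega> = s i \<omega>'" for i
  proof -
    have "s i -` {s i \<omega>} \<inter> space (F n) \<in> sets (F n)"
      using simple_functionD(2)[OF s(1)] .
    from At_dichotomy[OF this A] show ?thesis using \<omega> sp by auto
  qed
  then show ?thesis using s(2)[OF sp(1)] s(2)[OF sp(2)] LIMSEQ_unique by auto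
qed

lemma strongly_measurable_F_of_atom:
  assumes "strongly_measurable (F n) h" and \<omega>: "\<omega> \<in> space M"
  shows "h \<omega> = h (SOME \<omega>'. \<omega>' \<in> atom n \<omega>)"
proof (rule strongly_measurable_F_const_on_atom[OF assms(1)])
  show "atom n \<omega> \<in> At n" "\<omega> \<in> atom n \<omega>" using atom_in[OF \<omega>] by auto
  then show "(SOME \<omega>'. \<omega>' \<in> atom n \<omega>) \<in> atom n \<omega>" by (intro someI)
qed

lemma strongly_measurable_F_integral_atom:
  fixes h :: "'a \<Rightarrow> 'b::banach"
  assumes h: "strongly_measurable (F n) h" and A: "A \<in> At n" and \<omega>: "\<omega> \<in> A"
  shows "bochner_int M (\<lambda>\<omega>. indicator A \<omega> *\<^sub>R h \<omega>) = prob A *\<^sub>R h \<omega>"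
proof -
  define c where "c B = h (SOME \<omega>'. \<omega>' \<in> B)" for B
  have sub: "A \<subseteq> space M" using sets.sets_into_space[OF At_in_sets[OF A]] .
  have "h \<omega>' = c (atom n \<omega>')" if "\<omega>' \<in> space M" for \<omega>'
    using strongly_measurable_F_of_atom[OF h that] by (simp add: c_def)
  moreover from this have "(\<lambda>\<omega>'. indicator A \<omega>' *\<^sub>R h \<omega>') = (\<lambda>\<omega>'. indicator A \<omega>' *\<^sub>R c (atom n \<omega>'))"
    using sub by (auto simp: indicator_def fun_eq_iff)
  moreover have "{B \<in> At n. B \<subseteq> A} = {A}"
  proof -
    have "B = A" if "B \<in> At n" "B \<subseteq> A" for B
      using At_disjoint[OF that(1) A] At_nonempty[OF that(1)] that(2) by blast
    then show ?thesis using A by auto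
  qed
  moreover have "c A = h \<omega>"
    using calculation(1)[of \<omega>] \<omega> sub atom_eq[OF A \<omega>] by auto
  ultimately show ?thesis
    using bochner_int_of_atom[OF At_in_sets_F[OF A], of c] by simp
qed

text \<open>
  The atoms have positive probability, so a version of the conditional expectation is determined
  everywhere by its integrals over atoms.
\<close>

lemma cond_exp_eq:
  fixes f g :: "'a \<Rightarrow> 'b::banach"
  assumes g: "has_cond_exp M (F n) f g" and \<omega>: "\<omega> \<in> space M"
  shows "cond_exp M (F n) f \<omega> = g \<omega>"
proof -
  have h: "has_cond_exp M (F n) f (cond_exp M (F n) f)"
    using g someI_ex[of "\<lambda>g. has_cond_exp M (F n) f g"] by (auto simp: cond_exp_def)
  let ?A = "atom n \<omega>"
  have A: "?A \<in> At n" "\<omega> \<in> ?A" using atom_in[OF \<omega>] by auto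
  have "prob ?A *\<^sub>R cond_exp M (F n) f \<omega> = prob ?A *\<^sub>R g \<omega>"
    using g h At_in_sets_F[OF A(1)] strongly_measurable_F_integral_atom[OF _ A, of g]
      strongly_measurable_F_integral_atom[OF _ A, of "cond_exp M (F n) f"]
    by (auto simp: has_cond_exp_def)
  then show ?thesis using prob_At[OF A(1)] by auto
qed

lemma has_cond_exp_simple:
  fixes f g :: "'a \<Rightarrow> 'b::banach"
  assumes "simple_function M f" "simple_function (F n) g"
    and "\<And>X. X \<in> sets (F n) \<Longrightarrow> bochner_int M (\<lambda>\<omega>. indicator X \<omega> *\<^sub>R g \<omega>) = bochner_int M (\<lambda>\<omega>. indicator X \<omega> *\<^sub>R f \<omega>)"
  shows "has_cond_exp M (F n) f g"
proof -
  have "strongly_measurable (F n) g"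
    unfolding strongly_measurable_def using assms(2) by (intro exI[of _ "\<lambda>_. g"]) simp
  moreover have "bochner_integrable M f" "bochner_integrable M g"
    using bochner_int_simple_function(1)[OF assms(1)]
      bochner_int_simple_function(1)[OF simple_function_F_M[OF assms(2)]]
    by (auto simp: bochner_integrable_def)
  ultimately show ?thesis using assms(3) by (simp add: has_cond_exp_def)
qed

text \<open>
  The hypothesis on \<open>L\<^sup>p\<close> functions, freed from conditional expectations: applied to the final value
  \<open>c m\<close> of a martingale given by its values on atoms, the conditional expectations are the earlier
  values, and all norms are finite sums over atoms.
\<close>

lemma finite_martingale_inequality:
  fixes c :: "nat \<Rightarrow> 'a set \<Rightarrow> 'b::banach"
  assumes p: "0 < p" and T: "0 < T"
    and hyp: "\<And>f :: 'a \<Rightarrow> 'b. f \<in> Lp_space p M \<Longrightarrow>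
           Lp_norm p M f \<le> ennreal T *
             enn_powr (enn_powr (Lp_norm p M (cond_exp M (F 0) f)) p +
               (\<Sum>n. enn_powr (Lp_norm p M
                  (\<lambda>\<omega>. cond_exp M (F (Suc n)) f \<omega> - cond_exp M (F n) f \<omega>)) p)) (1 / p)"
    and mart: "\<And>k A. k < m \<Longrightarrow> A \<in> At k \<Longrightarrow> (\<Sum>B\<in>children k A. prob B *\<^sub>R c (Suc k) B) = prob A *\<^sub>R c k A"
    and zero: "c 0 (space M) = 0"
  shows "(\<Sum>A\<in>At m. prob A * norm (c m A) powr p) \<le>
    T powr p * (\<Sum>k<m. \<Sum>A\<in>At k. \<Sum>B\<in>children k A. prob B * norm (c (Suc k) B - c k A) powr p)"
proof -
  define f where "f \<omega> = c m (atom m \<omega>)" for \<omega>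
  define S where "S = (\<Sum>A\<in>At m. prob A * norm (c m A) powr p)"
  define D where "D k = (\<Sum>A\<in>At k. \<Sum>B\<in>children k A. prob B * norm (c (Suc k) B - c k A) powr p)" for k
  have S: "0 \<le> S" by (simp add: S_def sum_nonneg)
  have D: "0 \<le> D k" for k by (simp add: D_def sum_nonneg)
  have f: "simple_function M f" unfolding f_def by (rule simple_function_of_atom_M)
  have norm_f: "Lp_norm p M f = ennreal (S powr (1 / p))"
    unfolding S_def by (rule Lp_norm_of_atom) (simp add: f_def)
  have "strongly_measurable M f"
    unfolding strongly_measurable_def using f by (intro exI[of _ "\<lambda>_. f"]) simp
  then have fLp: "f \<in> Lp_space p M" using norm_f by (simp add: Lp_space_def)
  have ce_low: "cond_exp M (F n) f \<omega> = c n (atom n \<omega>)" if n: "n \<le> m" and \<omega>: "\<omega> \<in> space M" for n \<omega>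
  proof (rule cond_exp_eq[OF has_cond_exp_simple[OF f simple_function_of_atom] \<omega>])
    fix X assume X: "X \<in> sets (F n)"
    have Xk: "X \<in> sets (F k)" if "n \<le> k" for k using sets_F_mono[OF that] X by auto
    have "(\<Sum>A | A \<in> At k \<and> A \<subseteq> X. prob A *\<^sub>R c k A) = (\<Sum>A | A \<in> At n \<and> A \<subseteq> X. prob A *\<^sub>R c n A)"
      if "n \<le> k" "k \<le> m" for k
      using that
    proof (induction k rule: dec_induct)
      case (step k)
      have "(\<Sum>A | A \<in> At (Suc k) \<and> A \<subseteq> X. prob A *\<^sub>R c (Suc k) A) =
          (\<Sum>A | A \<in> At k \<and> A \<subseteq> X. prob A *\<^sub>R c k A)"
        unfolding sum_At_Suc[OF Xk[OF step.hyps(1)]]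
        using mart step.prems by (intro sum.cong) auto
      with step show ?case by simp
    qed simp
    from this[OF n order_refl]
    show "bochner_int M (\<lambda>\<omega>. indicator X \<omega> *\<^sub>R c n (atom n \<omega>)) = bochner_int M (\<lambda>\<omega>. indicator X \<omega> *\<^sub>R f \<omega>)"
      unfolding f_def using bochner_int_of_atom[OF X, of "c n"] bochner_int_of_atom[OF Xk[OF n], of "c m"]
      by metis
  qed
  have ce_high: "cond_exp M (F n) f \<omega> = f \<omega>" if n: "m \<le> n" and \<omega>: "\<omega> \<in> space M" for n \<omega>
    using simple_function_F_mono[OF simple_function_of_atom n]
    by (intro cond_exp_eq[OF has_cond_exp_simple[OF f] \<omega>]) (auto simp: f_def)
  have diff: "enn_powr (Lp_norm p M (\<lambda>\<omega>. cond_exp M (F (Suc n)) f \<omega> - cond_exp M (F n) f \<omega>)) p =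
      (if n < m then ennreal (D n) else 0)" for n
  proof (cases "n < m")
    case True
    define e where "e B = c (Suc n) B - c n (parent n B)" for B
    have "parent n (atom (Suc n) \<omega>) = atom n \<omega>" if \<omega>: "\<omega> \<in> space M" for \<omega>
    proof (rule parent_child)
      show "atom n \<omega> \<in> At n" using atom_in[OF \<omega>] by simp
      show "atom (Suc n) \<omega> \<in> children n (atom n \<omega>)"
        using atom_in[OF \<omega>, of n] atom_in[OF \<omega>, of "Suc n"]
          At_dichotomy_le[of "atom n \<omega>" n "atom (Suc n) \<omega>" "Suc n"]
        by (auto simp: children_def)
    qed
    then have "Lp_norm p M (\<lambda>\<omega>. cond_exp M (F (Suc n)) f \<omega> - cond_exp M (F n) f \<omega>) =
        ennreal ((\<Sum>B\<in>At (Suc n). prob B * norm (e B) powr p) powr (1 / p))"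
      using True by (intro Lp_norm_of_atom) (simp add: ce_low e_def)
    also have "(\<Sum>B\<in>At (Suc n). prob B * norm (e B) powr p) =
        (\<Sum>B | B \<in> At (Suc n) \<and> B \<subseteq> space M. prob B * norm (e B) powr p)"
      using Union_At[of "Suc n"] by (intro sum.cong) auto
    also have "\<dots> = (\<Sum>A | A \<in> At n \<and> A \<subseteq> space M. \<Sum>B\<in>children n A. prob B * norm (e B) powr p)"
      using sum_At_Suc[of "space M" n] sets.top[of "F n"] by (simp add: space_F)
    also have "\<dots> = (\<Sum>A\<in>At n. \<Sum>B\<in>children n A. prob B * norm (e B) powr p)"
      using Union_At[of n] by (intro sum.cong) auto
    also have "\<dots> = D n"
      unfolding D_def e_def by (intro sum.cong refl) (simp add: parent_child)
    finally show ?thesis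
      using True D p by (simp add: enn_powr_ennreal powr_powr)
  next
    case False
    then have "Lp_norm p M (\<lambda>\<omega>. cond_exp M (F (Suc n)) f \<omega> - cond_exp M (F n) f \<omega>) =
        ennreal ((\<Sum>B\<in>At 0. prob B * norm (0::'b) powr p) powr (1 / p))"
      by (intro Lp_norm_of_atom[where c = "\<lambda>_. 0"]) (simp add: ce_high)
    then show ?thesis using False by (simp add: enn_powr_def)
  qed
  have "Lp_norm p M (cond_exp M (F 0) f) =
      ennreal ((\<Sum>B\<in>At 0. prob B * norm (c 0 B) powr p) powr (1 / p))"
    by (intro Lp_norm_of_atom) (simp add: ce_low)
  then have first: "enn_powr (Lp_norm p M (cond_exp M (F 0) f)) p = 0"
    using zero by (simp add: At_0 enn_powr_def)
  have "(\<Sum>n. if n < m then ennreal (D n) else 0) = (\<Sum>n<m. if n < m then ennreal (D n) else 0)"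
    by (rule suminf_finite) auto
  also have "\<dots> = ennreal (\<Sum>n<m. D n)" using D by (simp add: sum_ennreal)
  finally have "Lp_norm p M f \<le> ennreal T * enn_powr (ennreal (\<Sum>n<m. D n)) (1 / p)"
    using hyp[OF fLp] by (simp add: first diff)
  then have "ennreal (S powr (1 / p)) \<le> ennreal (T * (\<Sum>n<m. D n) powr (1 / p))"
    using T D by (simp add: norm_f enn_powr_ennreal sum_nonneg ennreal_mult)
  then have "S powr (1 / p) \<le> T * (\<Sum>n<m. D n) powr (1 / p)"
    using T by (simp add: ennreal_le_iff)
  then have "(S powr (1 / p)) powr p \<le> (T * (\<Sum>n<m. D n) powr (1 / p)) powr p"
    using p by (intro powr_mono2) auto
  then show ?thesis
    using p S T D by (simp add: powr_powr powr_mult sum_nonneg flip: S_def D_def)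
qed

end

section \<open>Atoms with many visits to the collection\<close>

context atomic_filtration
begin

text \<open>
  Counting the members of the collection along the path of a point, level by level, turns Carleson sums
  into expectations.
\<close>

definition newcomers :: "nat \<Rightarrow> 'a set" where
  "newcomers i = \<Union> (At i - coll_C At ch i)"

definition visits :: "nat \<Rightarrow> nat \<Rightarrow> 'a \<Rightarrow> nat" where
  "visits n m \<omega> = card {i \<in> {n<..m}. \<omega> \<in> newcomers i}"

lemma newcomers_sets [measurable]: "newcomers i \<in> sets M"
  unfolding newcomers_def using finite_At At_in_sets by (intro sets.finite_Union) auto

lemma child_newcomers:
  assumes A: "A \<in> At n" and B: "B \<in> children n A"
  shows "B \<inter> newcomers (Suc n) = (if B = diamond ch n A then {} else B)"
proof (cases "B = diamond ch n A")
  case True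
  have "B \<inter> B' = {}" if "B' \<in> At (Suc n) - coll_C At ch (Suc n)" for B'
  proof -
    have "B \<in> coll_C At ch (Suc n)" using child_in_coll_C[OF A B] True by simp
    then have "B \<noteq> B'" using that by blast
    then show ?thesis using At_disjoint[OF child_At[OF B], of B'] that by blast
  qed
  then show ?thesis using True unfolding newcomers_def by auto
next
  case False
  then have "B \<in> At (Suc n) - coll_C At ch (Suc n)" using child_in_coll_C[OF A B] child_At[OF B] by simp
  then show ?thesis using False unfolding newcomers_def by auto
qed

lemma visits_first:
  assumes "n < m"
  shows "visits n m \<omega> = (if \<omega> \<in> newcomers (Suc n) then 1 else 0) + visits (Suc n) m \<omega>"
proof -
  have "{i \<in> {n<..m}. \<omega> \<in> newcomers i} =
      (if \<omega> \<in> newcomers (Suc n) then {Suc n} else {}) \<union> {i \<in> {Suc n<..m}. \<omega> \<in> newcomers i}"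
  proof (intro set_eqI)
    fix i
    show "i \<in> {i \<in> {n<..m}. \<omega> \<in> newcomers i} \<longleftrightarrow>
        i \<in> (if \<omega> \<in> newcomers (Suc n) then {Suc n} else {}) \<union> {i \<in> {Suc n<..m}. \<omega> \<in> newcomers i}"
      using assms by (cases "i = Suc n") auto
  qed
  then show ?thesis
    unfolding visits_def by (simp add: card_Un_disjoint)
qed

lemma visits_last:
  assumes "n \<le> m"
  shows "visits n (Suc m) \<omega> = (if \<omega> \<in> newcomers (Suc m) then 1 else 0) + visits n m \<omega>"
proof -
  have "{i \<in> {n<..Suc m}. \<omega> \<in> newcomers i} =
      (if \<omega> \<in> newcomers (Suc m) then {Suc m} else {}) \<union> {i \<in> {n<..m}. \<omega> \<in> newcomers i}"
    using assms by (auto simp: le_Suc_eq split: if_splits)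
  then show ?thesis
    unfolding visits_def by (simp add: card_Un_disjoint)
qed

lemma visits_measurable [measurable]: "visits n m \<in> measurable M (count_space UNIV)"
proof (induction m)
  case 0
  then show ?case by (simp add: visits_def)
next
  case (Suc m)
  show ?case
  proof (cases "n \<le> m")
    case True
    have eq: "visits n (Suc m) = (\<lambda>\<omega>. (if \<omega> \<in> newcomers (Suc m) then 1 else 0) + visits n m \<omega>)"
      using visits_last[OF True] by auto
    have [measurable]: "visits n m \<in> measurable M (count_space UNIV)" by (rule Suc.IH)
    show ?thesis unfolding eq by measurable
  next
    case False
    then show ?thesis by (simp add: visits_def)
  qed
qed

definition expected_visits :: "nat \<Rightarrow> nat \<Rightarrow> 'a set \<Rightarrow> real" where
  "expected_visits n m A = (\<Sum>i\<in>{n<..m}. prob (A \<inter> newcomers i))"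

lemma expected_visits_first:
  assumes nm: "n < m" and A: "A \<in> At n"
  shows "expected_visits n m A =
    (\<Sum>B\<in>children n A. (if B = diamond ch n A then 0 else prob B) + expected_visits (Suc n) m B)"
proof -
  have "{n<..m} = insert (Suc n) {Suc n<..m}" using nm by auto
  then have "expected_visits n m A = (\<Sum>i\<in>insert (Suc n) {Suc n<..m}. \<Sum>B\<in>children n A. prob (B \<inter> newcomers i))"
    unfolding expected_visits_def
    by (simp only:) (intro sum.cong refl prob_Int_eq_sum_children[OF A] newcomers_sets)
  also have "\<dots> = (\<Sum>B\<in>children n A. prob (B \<inter> newcomers (Suc n))) +
      (\<Sum>i\<in>{Suc n<..m}. \<Sum>B\<in>children n A. prob (B \<inter> newcomers i))"
    by simp
  also have "(\<Sum>i\<in>{Suc n<..m}. \<Sum>B\<in>children n A. prob (B \<inter> newcomers i)) =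
      (\<Sum>B\<in>children n A. expected_visits (Suc n) m B)"
    unfolding expected_visits_def by (rule sum.swap)
  also have "(\<Sum>B\<in>children n A. prob (B \<inter> newcomers (Suc n))) =
      (\<Sum>B\<in>children n A. if B = diamond ch n A then 0 else prob B)"
    by (intro sum.cong refl) (simp add: child_newcomers[OF A])
  finally show ?thesis by (simp add: sum.distrib)
qed

text \<open>
  Markov property at the time of the \<open>j\<close>-th visit: there are \<open>j\<close> visits until then, and afterwards the
  expectation is at most \<open>a\<close> times the probability of getting there.
\<close>

lemma expected_visits_restart:
  assumes "n \<le> m" and A: "A \<in> At n"
    and a: "\<And>k A. n \<le> k \<Longrightarrow> k \<le> m \<Longrightarrow> A \<in> At k \<Longrightarrow> expected_visits k m A \<le> a * prob A"
  shows "expected_visits n m A \<le> real j * prob A + a * prob (A \<inter> {\<omega> \<in> space M. j \<le> visits n m \<omega>})"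
  using assms
proof (induction n arbitrary: A j rule: inc_induct)
  case base
  have "0 \<le> a * prob A" using base(2)[OF order_refl order_refl base(1)] by (simp add: expected_visits_def)
  then have "0 \<le> a" using prob_At[OF base(1)] by (simp add: zero_le_mult_iff)
  then show ?case by (simp add: expected_visits_def)
next
  case (step n)
  note A = step.prems(1) and a = step.prems(2)
  show ?case
  proof (cases j)
    case 0
    have "A \<inter> space M = A" using sets.sets_into_space[OF At_in_sets[OF A]] by blast
    then show ?thesis using 0 a[OF order_refl _ A] step.hyps by simp
  next
    case (Suc j')
    let ?H = "\<lambda>n j. {\<omega> \<in> space M. j \<le> visits n m \<omega>}"
    have H: "?H k i \<in> sets M" for k i by measurable
    have child: "(if B = diamond ch n A then 0 else prob B) + expected_visits (Suc n) m B \<le>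
        real j * prob B + a * prob (B \<inter> ?H n j)" if B: "B \<in> children n A" for B
    proof (cases "B = diamond ch n A")
      case True
      then have "\<omega> \<notin> newcomers (Suc n)" if "\<omega> \<in> B" for \<omega>
        using child_newcomers[OF A B] that by auto
      then have "B \<inter> ?H n j = B \<inter> ?H (Suc n) j"
        using step.hyps by (auto simp: visits_first)
      then show ?thesis
        using True step.IH[OF child_At[OF B] a, of j] by simp
    next
      case False
      then have "\<omega> \<in> newcomers (Suc n)" if "\<omega> \<in> B" for \<omega>
        using child_newcomers[OF A B] that by auto
      then have "B \<inter> ?H n j = B \<inter> ?H (Suc n) j'"
        using step.hyps Suc by (auto simp: visits_first)
      then show ?thesis
        using False step.IH[OF child_At[OF B] a, of j'] Suc by (simp add: algebra_simps)
    qed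
    have "expected_visits n m A \<le> (\<Sum>B\<in>children n A. real j * prob B + a * prob (B \<inter> ?H n j))"
      unfolding expected_visits_first[OF step.hyps(2) A] by (intro sum_mono child)
    also have "\<dots> = real j * prob A + a * prob (A \<inter> ?H n j)"
      unfolding prob_eq_sum_children[OF A] prob_Int_eq_sum_children[OF A H]
      by (simp add: sum.distrib sum_distrib_left)
    finally show ?thesis .
  qed
qed

text \<open>
  If no atom has a high chance of \<open>j\<close> visits, then the largest ratio \<open>a\<close> between expected visits and
  probability satisfies \<open>a \<le> j + (1 - \<epsilon>) a\<close>.
\<close>

lemma expected_visits_bound:
  assumes \<epsilon>: "0 < \<epsilon>" "\<epsilon> \<le> 1"
    and poor: "\<And>n m A. n \<le> m \<Longrightarrow> A \<in> At n \<Longrightarrow>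
      prob (A \<inter> {\<omega> \<in> space M. j \<le> visits n m \<omega>}) \<le> (1 - \<epsilon>) * prob A"
    and nm: "n \<le> m" and A: "A \<in> At n"
  shows "expected_visits n m A \<le> real j / \<epsilon> * prob A"
proof -
  define R where "R = (\<lambda>(k, B). expected_visits k m B / prob B) ` (SIGMA k:{..m}. At k)"
  have fin: "finite R" unfolding R_def using finite_At by auto
  have ratio: "expected_visits k m B / prob B \<in> R" if "k \<le> m" "B \<in> At k" for k B
    unfolding R_def using that by force
  define a where "a = Max R"
  have le: "expected_visits k m B \<le> a * prob B" if "k \<le> m" "B \<in> At k" for k B
    using Max_ge[OF fin ratio[OF that]] prob_At[OF that(2)] by (simp add: a_def divide_le_eq)
  have "a \<in> R" unfolding a_def using fin ratio[OF nm A] by (intro Max_in) auto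
  then obtain k B where k: "k \<le> m" "B \<in> At k" "a = expected_visits k m B / prob B"
    by (auto simp: R_def)
  have pos: "0 < prob B" using prob_At[OF k(2)] .
  have "0 \<le> expected_visits k m B" by (simp add: expected_visits_def sum_nonneg)
  then have a0: "0 \<le> a" using k(3) pos by simp
  have "a * prob B = expected_visits k m B" using k(3) pos by simp
  also have "\<dots> \<le> real j * prob B + a * prob (B \<inter> {\<omega> \<in> space M. j \<le> visits k m \<omega>})"
    by (rule expected_visits_restart[OF k(1,2)]) (rule le)
  also have "\<dots> \<le> real j * prob B + a * ((1 - \<epsilon>) * prob B)"
    using poor[OF k(1,2)] a0 by (intro add_left_mono mult_left_mono)
  finally have "\<epsilon> * a * prob B \<le> real j * prob B" by (simp add: algebra_simps)
  then have "\<epsilon> * a \<le> real j" using pos by simp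
  then have "a \<le> real j / \<epsilon>" using \<epsilon>(1) by (simp add: pos_le_divide_eq mult.commute)
  then show ?thesis using le[OF nm A] prob_At[OF A] by (meson less_imp_le mult_right_mono order_trans)
qed

text \<open>
  A member of the collection that is strictly smaller than \<open>I\<close> can only appear at a later level than \<open>I\<close>,
  hence it is counted among the newcomers.
\<close>

lemma collection_E_sum_le:
  assumes I: "I \<in> At n" and J: "finite \<J>" "\<J> \<subseteq> {J \<in> coll_E At ch. J \<subseteq> I}"
  shows "\<exists>m\<ge>n. (\<Sum>J\<in>\<J>. prob J) \<le> prob I + expected_visits n m I"
proof -
  have "\<forall>J\<in>\<J>. \<exists>i. J \<in> At i - coll_C At ch i" using J(2) by (auto simp: coll_E_def)
  then obtain lev where lev: "\<And>J. J \<in> \<J> \<Longrightarrow> J \<in> At (lev J) - coll_C At ch (lev J)" by metis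
  define m where "m = Max (insert n (lev ` \<J>))"
  have m: "n \<le> m" "\<And>J. J \<in> \<J> \<Longrightarrow> lev J \<le> m" using J(1) by (auto simp: m_def)
  have later: "n < lev J" if "J \<in> \<J>" "J \<noteq> I" for J
  proof (rule ccontr)
    assume "\<not> n < lev J"
    then have le: "lev J \<le> n" by simp
    have J': "J \<in> At (lev J)" "J \<subseteq> I" using lev that J(2) by auto
    have "I \<subseteq> J"
      using At_dichotomy_le[OF J'(1) I le] J' At_nonempty[OF J'(1)] by blast
    then show False using J'(2) that(2) by simp
  qed
  define N where "N i = {J \<in> At i - coll_C At ch i. J \<subseteq> I}" for i
  have finN: "finite (N i)" for i using finite_At by (simp add: N_def)
  have sub: "\<J> \<subseteq> insert I (\<Union>i\<in>{n<..m}. N i)"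
  proof
    fix J assume "J \<in> \<J>"
    then show "J \<in> insert I (\<Union>i\<in>{n<..m}. N i)"
      using lev[of J] later[of J] m(2)[of J] J(2) by (cases "J = I") (auto simp: N_def)
  qed
  have "sum prob \<J> \<le> sum prob (insert I (\<Union>i\<in>{n<..m}. N i))"
    using finN sub by (intro sum_mono2) auto
  also have "\<dots> \<le> prob I + sum prob (\<Union>i\<in>{n<..m}. N i)"
    using finN by (cases "I \<in> (\<Union>i\<in>{n<..m}. N i)") (auto simp: insert_absorb)
  also have "sum prob (\<Union>i\<in>{n<..m}. N i) \<le> (\<Sum>i\<in>{n<..m}. sum prob (N i))"
  proof -
    have "sum prob (snd ` (SIGMA i:{n<..m}. N i)) \<le> sum (prob \<circ> snd) (SIGMA i:{n<..m}. N i)"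
      using finN by (intro sum_image_le) auto
    moreover have "snd ` (SIGMA i:{n<..m}. N i) = (\<Union>i\<in>{n<..m}. N i)" by force
    moreover have "sum (prob \<circ> snd) (SIGMA i:{n<..m}. N i) = (\<Sum>i\<in>{n<..m}. sum prob (N i))"
      using finN by (simp add: sum.Sigma case_prod_beta comp_def)
    ultimately show ?thesis by simp
  qed
  also have "(\<Sum>i\<in>{n<..m}. sum prob (N i)) \<le> expected_visits n m I"
    unfolding expected_visits_def
  proof (rule sum_mono)
    fix i
    have disj: "disjoint_family_on (\<lambda>J. J) (N i)"
      using At_disjoint by (auto simp: disjoint_family_on_def N_def)
    have "sum prob (N i) = prob (\<Union>J\<in>N i. J)"
      using finN At_in_sets disj by (intro finite_measure_finite_Union[symmetric]) (auto simp: N_def)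
    also have "\<dots> \<le> prob (I \<inter> newcomers i)"
    proof (rule finite_measure_mono)
      show "(\<Union>J\<in>N i. J) \<subseteq> I \<inter> newcomers i" by (auto simp: N_def newcomers_def)
    qed (use At_in_sets[OF I] newcomers_sets in blast)
    finally show "sum prob (N i) \<le> prob (I \<inter> newcomers i)" .
  qed
  finally show ?thesis using m(1) by (intro exI[of _ m]) simp
qed

lemma exists_rich_atom:
  assumes infinite: "carleson_constant M (coll_E At ch) = \<infinity>" and \<epsilon>: "0 < \<epsilon>" "\<epsilon> \<le> 1"
  shows "\<exists>n m I. n \<le> m \<and> I \<in> At n \<and> prob (I \<inter> {\<omega> \<in> space M. visits n m \<omega> < j}) \<le> \<epsilon> * prob I"
proof (rule ccontr)
  assume neg: "\<not> ?thesis"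
  have poor: "prob (A \<inter> {\<omega> \<in> space M. j \<le> visits n m \<omega>}) \<le> (1 - \<epsilon>) * prob A"
    if "n \<le> m" "A \<in> At n" for n m A
  proof -
    let ?G = "A \<inter> {\<omega> \<in> space M. j \<le> visits n m \<omega>}"
    have AM: "A \<in> sets M" using At_in_sets[OF that(2)] .
    have [measurable]: "A \<in> sets M" by fact
    have "A - A \<inter> {\<omega> \<in> space M. visits n m \<omega> < j} = ?G"
      using sets.sets_into_space[OF AM] by auto
    moreover have "A \<inter> {\<omega> \<in> space M. visits n m \<omega> < j} \<in> sets M" by measurable
    ultimately have "prob ?G = prob A - prob (A \<inter> {\<omega> \<in> space M. visits n m \<omega> < j})"
      using finite_measure_Diff[OF AM, of "A \<inter> {\<omega> \<in> space M. visits n m \<omega> < j}"] by simp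
    moreover have "\<epsilon> * prob A < prob (A \<inter> {\<omega> \<in> space M. visits n m \<omega> < j})"
      using neg that by (meson not_le)
    ultimately show ?thesis by (simp add: algebra_simps)
  qed
  have "(\<Sum>\<^sub>\<infinity>J\<in>{J \<in> coll_E At ch. J \<subseteq> I}. emeasure M J) / emeasure M I \<le> ennreal (1 + real j / \<epsilon>)"
    if "I \<in> coll_E At ch" for I
  proof -
    from that obtain n where I: "I \<in> At n" by (auto simp: coll_E_def)
    have pos: "0 < prob I" using prob_At[OF I] .
    have "(\<Sum>\<^sub>\<infinity>J\<in>{J \<in> coll_E At ch. J \<subseteq> I}. emeasure M J) \<le> ennreal ((1 + real j / \<epsilon>) * prob I)"
    proof (rule infsum_le_finite_sums)
      fix \<J> assume \<J>: "finite \<J>" "\<J> \<subseteq> {J \<in> coll_E At ch. J \<subseteq> I}"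
      obtain m where m: "n \<le> m" "(\<Sum>J\<in>\<J>. prob J) \<le> prob I + expected_visits n m I"
        using collection_E_sum_le[OF I \<J>] by blast
      have "(\<Sum>J\<in>\<J>. prob J) \<le> (1 + real j / \<epsilon>) * prob I"
        using m(2) expected_visits_bound[OF \<epsilon> poor m(1) I] by (simp add: algebra_simps)
      moreover have "(\<Sum>J\<in>\<J>. emeasure M J) = ennreal (\<Sum>J\<in>\<J>. prob J)"
        by (simp add: emeasure_eq_measure)
      ultimately show "(\<Sum>J\<in>\<J>. emeasure M J) \<le> ennreal ((1 + real j / \<epsilon>) * prob I)"
        by (simp add: ennreal_leI)
    qed (auto intro: nonneg_summable_on_complete)
    then have "(\<Sum>\<^sub>\<infinity>J\<in>{J \<in> coll_E At ch. J \<subseteq> I}. emeasure M J) / emeasure M I \<le>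
        ennreal ((1 + real j / \<epsilon>) * prob I) / ennreal (prob I)"
      unfolding emeasure_eq_measure by (rule divide_right_mono_ennreal)
    also have "\<dots> = ennreal (1 + real j / \<epsilon>)" using pos \<epsilon> by (subst divide_ennreal) auto
    finally show ?thesis .
  qed
  then have "carleson_constant M (coll_E At ch) \<le> ennreal (1 + real j / \<epsilon>)"
    unfolding carleson_constant_def by (rule SUP_least)
  then show False using infinite by (simp add: top_unique)
qed

end

section \<open>Dyadic martingales and their states\<close>

text \<open>
  The pair \<open>(j, k)\<close> stands for the dyadic interval \<open>[k/2\<^sup>j, (k+1)/2\<^sup>j)\<close>, so even indices belong to
  left halves.  The Haar sum with coefficients \<open>y\<close> over all longer intervals is constant on this
  interval, with value \<open>dyadic_sum y j k\<close>.
\<close>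

primrec dyadic_sum :: "(nat \<Rightarrow> nat \<Rightarrow> 'b::real_vector) \<Rightarrow> nat \<Rightarrow> nat \<Rightarrow> 'b" where
  "dyadic_sum y 0 k = 0"
| "dyadic_sum y (Suc j) k =
    dyadic_sum y j (k div 2) + (if even k then y j (k div 2) else - y j (k div 2))"

primrec dyadic_cost :: "real \<Rightarrow> (nat \<Rightarrow> nat \<Rightarrow> 'b::real_normed_vector) \<Rightarrow> nat \<Rightarrow> nat \<Rightarrow> real" where
  "dyadic_cost p y 0 k = 0"
| "dyadic_cost p y (Suc j) k = dyadic_cost p y j (k div 2) + norm (y j (k div 2)) powr p"

text \<open>
  The average of \<open>\<phi>\<close> over the descendants of \<open>(j, k)\<close> that are \<open>n\<close> generations younger.
\<close>

primrec dyadic_mean :: "(nat \<Rightarrow> nat \<Rightarrow> real) \<Rightarrow> nat \<Rightarrow> nat \<Rightarrow> nat \<Rightarrow> real" where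
  "dyadic_mean \<phi> 0 j k = \<phi> j k"
| "dyadic_mean \<phi> (Suc n) j k = (dyadic_mean \<phi> n (Suc j) (2 * k) + dyadic_mean \<phi> n (Suc j) (2 * k + 1)) / 2"

lemma dyadic_mean_bounds:
  assumes "\<And>i. i < 2 ^ (j + n) \<Longrightarrow> 0 \<le> \<phi> (j + n) i \<and> \<phi> (j + n) i \<le> b" and "k < 2 ^ j"
  shows "0 \<le> dyadic_mean \<phi> n j k \<and> dyadic_mean \<phi> n j k \<le> b"
  using assms
proof (induction n arbitrary: j k)
  case (Suc n)
  have "0 \<le> dyadic_mean \<phi> n (Suc j) i \<and> dyadic_mean \<phi> n (Suc j) i \<le> b" if "i < 2 ^ Suc j" for i
    using Suc.prems(1) that by (intro Suc.IH) auto
  from this[of "2 * k"] this[of "2 * k + 1"] show ?case using Suc.prems(2) by auto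
qed simp

text \<open>
  In the state \<open>(j, k, v)\<close> the Haar function of the interval \<open>(j, k)\<close> is being copied, with current value
  \<open>v\<close>.  A dyadic martingale \<open>g\<close> is extended to states affinely in \<open>v\<close>, the value \<open>1\<close>
  standing for the left half and \<open>- 1\<close> for the right half.  States with \<open>j = L\<close> are final.
\<close>

definition interpolate :: "nat \<Rightarrow> (nat \<Rightarrow> nat \<Rightarrow> 'b::real_vector) \<Rightarrow> nat \<times> nat \<times> real \<Rightarrow> 'b" where
  "interpolate L g = (\<lambda>(j, k, v).
    if j < L then ((1 + v) / 2) *\<^sub>R g (Suc j) (2 * k) + ((1 - v) / 2) *\<^sub>R g (Suc j) (2 * k + 1) else g j k)"

definition dyadic_martingale :: "nat \<Rightarrow> (nat \<Rightarrow> nat \<Rightarrow> 'b::real_vector) \<Rightarrow> bool" where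
  "dyadic_martingale L g \<longleftrightarrow>
    (\<forall>j<L. \<forall>k. g j k = (1 / 2) *\<^sub>R g (Suc j) (2 * k) + (1 / 2) *\<^sub>R g (Suc j) (2 * k + 1))"

lemma dyadic_martingale_dyadic_sum: "dyadic_martingale L (dyadic_sum y)"
proof -
  have half: "x = (1 / 2) *\<^sub>R (x + z) + (1 / 2) *\<^sub>R (x - z)" for x z :: 'a
    by (simp add: scaleR_add_right[symmetric] scaleR_diff_right[symmetric] flip: scaleR_left.add)
  show ?thesis unfolding dyadic_martingale_def
    using half[of "dyadic_sum y _ _" "y _ _"] by simp
qed

lemma dyadic_martingale_dyadic_mean: "dyadic_martingale L (\<lambda>j. dyadic_mean \<phi> (L - j) j)"
  unfolding dyadic_martingale_def
proof (intro allI impI)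
  fix j k assume "j < L"
  then have "L - j = Suc (L - Suc j)" by simp
  then show "dyadic_mean \<phi> (L - j) j k = (1 / 2) *\<^sub>R dyadic_mean \<phi> (L - Suc j) (Suc j) (2 * k) +
      (1 / 2) *\<^sub>R dyadic_mean \<phi> (L - Suc j) (Suc j) (2 * k + 1)" by simp
qed

lemma interpolate_start:
  assumes "dyadic_martingale L g"
  shows "interpolate L g (j, k, 0) = g j k"
  using assms by (cases "j < L") (auto simp: interpolate_def dyadic_martingale_def)

lemma interpolate_dyadic_sum:
  assumes "j < L"
  shows "interpolate L (dyadic_sum y) (j, k, v) = dyadic_sum y j k + v *\<^sub>R y j k"
proof -
  have "x + v *\<^sub>R z = ((1 + v) / 2) *\<^sub>R (x + z) + ((1 - v) / 2) *\<^sub>R (x - z)" for x z :: 'a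
  proof -
    have "((1 + v) / 2) *\<^sub>R (x + z) + ((1 - v) / 2) *\<^sub>R (x - z) =
        ((1 + v) / 2 + (1 - v) / 2) *\<^sub>R x + ((1 + v) / 2 - (1 - v) / 2) *\<^sub>R z"
      by (simp only: scaleR_add_right scaleR_diff_right scaleR_left.add scaleR_left.diff) simp
    also have "(1 + v) / 2 + (1 - v) / 2 = 1" by (simp add: field_simps)
    also have "(1 + v) / 2 - (1 - v) / 2 = v" by (simp add: field_simps)
    finally show ?thesis by simp
  qed
  then show ?thesis using assms by (simp add: interpolate_def)
qed

definition move :: "nat \<Rightarrow> nat \<times> nat \<times> real \<Rightarrow> real \<Rightarrow> nat \<times> nat \<times> real" where
  "move L = (\<lambda>(j, k, v) u. if L \<le> j then (j, k, v)
    else if u \<ge> 1 then (Suc j, 2 * k, 0) else if u \<le> - 1 then (Suc j, 2 * k + 1, 0) else (j, k, u))"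

text \<open>
  Passing to the centre of a half when the value is a sign does not change the extended martingale;
  this is why the next Haar function may start on an atom as soon as the previous one is finished there.
\<close>

lemma interpolate_move:
  assumes g: "dyadic_martingale L g" and "j < L" and u: "\<bar>u\<bar> \<le> 1"
  shows "interpolate L g (move L (j, k, v) u) = interpolate L g (j, k, u)"
proof -
  consider "u = 1" | "u = - 1" | "- 1 < u" "u < 1" using u by fastforce
  then show ?thesis
    using assms(2) interpolate_start[OF g, of "Suc j"] by cases (auto simp: move_def, auto simp: interpolate_def)
qed

text \<open>
  The part of \<open>\<Sum>\<parallel>x\<^sub>I\<parallel>\<^sup>p\<close> spent so far: in full for the finished Haar functions, and in proportion to the
  potential for the one being copied.
\<close>

definition state_cost :: "real \<Rightarrow> nat \<Rightarrow> (nat \<Rightarrow> nat \<Rightarrow> 'b::real_normed_vector) \<Rightarrow> nat \<times> nat \<times> real \<Rightarrow> real" where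
  "state_cost p L y = (\<lambda>(j, k, v).
    dyadic_cost p y j k + (if j < L then haar_potential p v * norm (y j k) powr p else 0))"

lemma state_cost_move:
  assumes "j < L" and u: "\<bar>u\<bar> \<le> 1"
  shows "state_cost p L y (move L (j, k, v) u) = dyadic_cost p y j k + haar_potential p u * norm (y j k) powr p"
proof -
  consider "u = 1" | "u = - 1" | "- 1 < u" "u < 1" using u by fastforce
  then show ?thesis
    using assms(1) by cases (auto simp: move_def state_cost_def haar_potential_def)
qed

section \<open>Copying Haar functions along the filtration\<close>

text \<open>
  Haar functions of generation less than \<open>L\<close> are copied inside the atom \<open>I0\<close> of level \<open>n0\<close>.
\<close>

locale haar_embedding = atomic_filtration M F At ch
  for M :: "'a measure" and F At ch +
  fixes p :: real and L n0 :: nat and I0 :: "'a set"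
  assumes p: "1 < p" "p \<le> 2" and I0: "I0 \<in> At n0"
begin

definition good_split :: "nat \<Rightarrow> 'a set \<Rightarrow> real \<Rightarrow> ('a set \<Rightarrow> real) \<Rightarrow> bool" where
  "good_split n A v w \<longleftrightarrow> (\<forall>B\<in>children n A. \<bar>w B\<bar> \<le> 1) \<and>
    (\<Sum>B\<in>children n A. prob B * w B) = v * prob A \<and>
    (\<Sum>B\<in>children n A. prob B * \<bar>w B - v\<bar> powr p) \<le>
      4 powr (2 - p) * ((\<Sum>B\<in>children n A. prob B * haar_potential p (w B)) - prob A * haar_potential p v) \<and>
    (\<Sum>B\<in>children n A. prob B * ((if B = diamond ch n A then 1 else 3/2) * (if \<bar>w B\<bar> < 1 then 1 else 1/3))) \<le> prob A"

definition split :: "nat \<Rightarrow> 'a set \<Rightarrow> real \<Rightarrow> 'a set \<Rightarrow> real" where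
  "split n A v = (SOME w. good_split n A v w)"

lemma good_split_split:
  assumes A: "A \<in> At n" and v: "\<bar>v\<bar> < 1"
  shows "good_split n A v (split n A v)"
proof -
  have "\<exists>w. good_split n A v w"
    unfolding good_split_def prob_eq_sum_children[OF A]
    using prob_At[OF child_At] prob_le_diamond[OF A]
    by (intro splitting_exists[where P = prob] finite_children diamond_child[OF A] v p)
  then show ?thesis unfolding split_def by (rule someI_ex)
qed

text \<open>
  Inside \<open>I0\<close>, an atom of a level above \<open>n0\<close> inherits the state of its parent, with the value
  changed by the split of the parent.  The start state \<open>(0, 0, 0)\<close> for all other atoms makes the copied martingale vanish there.
\<close>

primrec state :: "nat \<Rightarrow> 'a set \<Rightarrow> nat \<times> nat \<times> real" where
  "state 0 B = (0, 0, 0)"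
| "state (Suc n) B = (if n0 \<le> n \<and> B \<subseteq> I0
    then move L (state n (parent n B)) (split n (parent n B) (snd (snd (state n (parent n B)))) B)
    else (0, 0, 0))"

lemma state_outside: "n \<le> n0 \<or> \<not> A \<subseteq> I0 \<Longrightarrow> state n A = (0, 0, 0)"
  by (cases n) auto

declare state.simps(2) [simp del]

lemma state_child:
  assumes "n0 \<le> n" "A \<in> At n" "A \<subseteq> I0" "B \<in> children n A" "state n A = (j, k, v)"
  shows "state (Suc n) B = move L (j, k, v) (split n A v B)"
proof -
  have "B \<subseteq> I0" using assms child_subset by blast
  then show ?thesis using assms by (simp add: parent_child state.simps(2))
qed

lemma state_valid:
  assumes "A \<in> At n" "state n A = (j, k, v)"
  shows "j \<le> L \<and> k < 2 ^ j \<and> \<bar>v\<bar> < 1"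
  using assms
proof (induction n arbitrary: A j k v)
  case (Suc n)
  show ?case
  proof (cases "n0 \<le> n \<and> A \<subseteq> I0")
    case True
    obtain A' where A': "A' \<in> At n" "A \<in> children n A'" using child_of_some[OF Suc.prems(1)] by blast
    then have "parent n A = A'" by (rule parent_child)
    moreover obtain j' k' v' where s: "state n A' = (j', k', v')" by (cases "state n A'") auto
    moreover have "j' \<le> L \<and> k' < 2 ^ j' \<and> \<bar>v'\<bar> < 1" using Suc.IH[OF A'(1) s] .
    ultimately show ?thesis
      using True Suc.prems(2) by (auto simp: move_def state.simps(2) split: if_splits)
  next
    case False
    then have "state (Suc n) A = (0, 0, 0)" unfolding state.simps(2) by (rule if_not_P)
    then show ?thesis using Suc.prems(2) by auto
  qed
qed auto

abbreviation inner :: "nat \<Rightarrow> 'a set set" where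
  "inner n \<equiv> {A. A \<in> At n \<and> A \<subseteq> I0}"

lemma finite_inner: "finite (inner n)"
  using finite_At by simp

lemma sum_inner_Suc:
  fixes h :: "'a set \<Rightarrow> 'c::comm_monoid_add"
  assumes "n0 \<le> n"
  shows "sum h (inner (Suc n)) = (\<Sum>A\<in>inner n. sum h (children n A))"
  using sum_At_Suc[of I0 n h] sets_F_mono[OF assms] At_in_sets_F[OF I0] by blast

lemma inner_start: "inner n0 = {I0}"
proof -
  have "A = I0" if "A \<in> At n0" "A \<subseteq> I0" for A
    using At_disjoint[OF that(1) I0] At_nonempty[OF that(1)] that(2) by blast
  then show ?thesis using I0 by auto
qed

text \<open>
  The split has mean \<open>v\<close> and the extension of \<open>g\<close> is affine in \<open>v\<close>.
\<close>

lemma interpolate_child_sum: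
  assumes n: "n0 \<le> n" and A: "A \<in> At n" "A \<subseteq> I0" and g: "dyadic_martingale L g"
  shows "(\<Sum>B\<in>children n A. prob B *\<^sub>R interpolate L g (state (Suc n) B)) = prob A *\<^sub>R interpolate L g (state n A)"
proof -
  obtain j k v where s: "state n A = (j, k, v)" by (cases "state n A") auto
  note valid = state_valid[OF A(1) s]
  note child = state_child[OF n A _ s]
  show ?thesis
  proof (cases "j < L")
    case True
    let ?w = "split n A v" and ?a = "g (Suc j) (2 * k)" and ?b = "g (Suc j) (2 * k + 1)"
    have w: "\<And>B. B \<in> children n A \<Longrightarrow> \<bar>?w B\<bar> \<le> 1" "(\<Sum>B\<in>children n A. prob B * ?w B) = v * prob A"
      using good_split_split[OF A(1), of v] valid by (auto simp: good_split_def)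
    have "(\<Sum>B\<in>children n A. prob B *\<^sub>R interpolate L g (state (Suc n) B)) =
        (\<Sum>B\<in>children n A. ((prob B + prob B * ?w B) / 2) *\<^sub>R ?a + ((prob B - prob B * ?w B) / 2) *\<^sub>R ?b)"
    proof (intro sum.cong refl)
      fix B assume B: "B \<in> children n A"
      have "interpolate L g (state (Suc n) B) = ((1 + ?w B) / 2) *\<^sub>R ?a + ((1 - ?w B) / 2) *\<^sub>R ?b"
        using True unfolding child[OF B] interpolate_move[OF g True w(1)[OF B]] by (simp add: interpolate_def)
      then show "prob B *\<^sub>R interpolate L g (state (Suc n) B) =
          ((prob B + prob B * ?w B) / 2) *\<^sub>R ?a + ((prob B - prob B * ?w B) / 2) *\<^sub>R ?b"
        by (simp add: scaleR_add_right distrib_left right_diff_distrib)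
    qed
    also have "\<dots> = (\<Sum>B\<in>children n A. (prob B + prob B * ?w B) / 2) *\<^sub>R ?a +
        (\<Sum>B\<in>children n A. (prob B - prob B * ?w B) / 2) *\<^sub>R ?b"
      by (simp add: sum.distrib scaleR_left.sum)
    also have "(\<Sum>B\<in>children n A. (prob B + prob B * ?w B) / 2) = prob A * ((1 + v) / 2)"
      using w(2) prob_eq_sum_children[OF A(1)]
      by (simp add: sum_divide_distrib[symmetric] sum.distrib algebra_simps)
    also have "(\<Sum>B\<in>children n A. (prob B - prob B * ?w B) / 2) = prob A * ((1 - v) / 2)"
      using w(2) prob_eq_sum_children[OF A(1)]
      by (simp add: sum_divide_distrib[symmetric] sum_subtractf algebra_simps)
    finally show ?thesis using True by (simp add: s interpolate_def scaleR_add_right)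
  next
    case False
    then have "(\<Sum>B\<in>children n A. prob B *\<^sub>R interpolate L g (state (Suc n) B)) =
        (\<Sum>B\<in>children n A. prob B *\<^sub>R interpolate L g (j, k, v))"
      by (intro sum.cong refl) (simp add: child move_def)
    then show ?thesis using prob_eq_sum_children[OF A(1)] by (simp add: s scaleR_left.sum)
  qed
qed

lemma interpolate_inner_sum:
  assumes "n0 \<le> n" and g: "dyadic_martingale L g"
  shows "(\<Sum>A\<in>inner n. prob A *\<^sub>R interpolate L g (state n A)) = prob I0 *\<^sub>R g 0 0"
  using assms(1)
proof (induction n rule: dec_induct)
  case base
  then show ?case unfolding inner_start by (simp add: state_outside interpolate_start[OF g])
next
  case (step k)
  have "(\<Sum>A\<in>inner (Suc k). prob A *\<^sub>R interpolate L g (state (Suc k) A)) =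
      (\<Sum>A\<in>inner k. prob A *\<^sub>R interpolate L g (state k A))"
    unfolding sum_inner_Suc[OF step.hyps(1)]
    using interpolate_child_sum[OF step.hyps(1) _ _ g] by (intro sum.cong) auto
  then show ?case using step.IH by simp
qed

text \<open>
  The increment on a child \<open>B\<close> is \<open>(w B - v) *\<^sub>R y j k\<close>, a scalar jump times a fixed vector, so the
  estimate for splits applies after multiplication by \<open>\<parallel>y j k\<parallel>\<^sup>p\<close>.
\<close>

lemma child_difference_cost:
  assumes n: "n0 \<le> n" and A: "A \<in> At n" "A \<subseteq> I0"
  shows "(\<Sum>B\<in>children n A. prob B * norm (interpolate L (dyadic_sum y) (state (Suc n) B) -
        interpolate L (dyadic_sum y) (state n A)) powr p) \<le>
      4 powr (2 - p) * ((\<Sum>B\<in>children n A. prob B * state_cost p L y (state (Suc n) B)) - prob A * state_cost p L y (state n A))"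
proof -
  obtain j k v where s: "state n A = (j, k, v)" by (cases "state n A") auto
  note valid = state_valid[OF A(1) s]
  note child = state_child[OF n A _ s]
  show ?thesis
  proof (cases "j < L")
    case True
    let ?w = "split n A v" and ?c = "norm (y j k) powr p" and ?d = "dyadic_cost p y j k"
    have w: "\<And>B. B \<in> children n A \<Longrightarrow> \<bar>?w B\<bar> \<le> 1"
      "(\<Sum>B\<in>children n A. prob B * \<bar>?w B - v\<bar> powr p) \<le>
      4 powr (2 - p) * ((\<Sum>B\<in>children n A. prob B * haar_potential p (?w B)) - prob A * haar_potential p v)"
      using good_split_split[OF A(1), of v] valid by (auto simp: good_split_def)
    have "(\<Sum>B\<in>children n A. prob B * norm (interpolate L (dyadic_sum y) (state (Suc n) B) -
        interpolate L (dyadic_sum y) (state n A)) powr p) = (\<Sum>B\<in>children n A. prob B * \<bar>?w B - v\<bar> powr p * ?c)"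
    proof (intro sum.cong refl)
      fix B assume B: "B \<in> children n A"
      have "interpolate L (dyadic_sum y) (state (Suc n) B) - interpolate L (dyadic_sum y) (state n A) = (?w B - v) *\<^sub>R y j k"
        using w(1)[OF B] True
        by (simp add: s child[OF B] interpolate_move[OF dyadic_martingale_dyadic_sum] interpolate_dyadic_sum scaleR_diff_left)
      then show "prob B * norm (interpolate L (dyadic_sum y) (state (Suc n) B) -
        interpolate L (dyadic_sum y) (state n A)) powr p = prob B * \<bar>?w B - v\<bar> powr p * ?c"
        by (simp add: powr_mult)
    qed
    also have "\<dots> = (\<Sum>B\<in>children n A. prob B * \<bar>?w B - v\<bar> powr p) * ?c"
      by (simp add: sum_distrib_right)
    also have "\<dots> \<le> (4 powr (2 - p) * ((\<Sum>B\<in>children n A. prob B * haar_potential p (?w B)) - prob A * haar_potential p v)) * ?c"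
      using w(2) by (rule mult_right_mono) simp
    also have "\<dots> = 4 powr (2 - p) * ((\<Sum>B\<in>children n A. prob B * (?d + haar_potential p (?w B) * ?c)) -
        prob A * (?d + haar_potential p v * ?c))"
      using prob_eq_sum_children[OF A(1)]
      by (simp add: algebra_simps sum.distrib sum_distrib_left sum_distrib_right)
    also have "(\<Sum>B\<in>children n A. prob B * (?d + haar_potential p (?w B) * ?c)) =
        (\<Sum>B\<in>children n A. prob B * state_cost p L y (state (Suc n) B))"
      using True w(1) by (intro sum.cong refl) (simp add: child state_cost_move)
    also have "?d + haar_potential p v * ?c = state_cost p L y (state n A)"
      using True by (simp add: s state_cost_def)
    finally show ?thesis .
  next
    case False
    then have const: "state (Suc n) B = (j, k, v)" if "B \<in> children n A" for B
      using that by (simp add: child move_def)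
    show ?thesis
      using prob_eq_sum_children[OF A(1)] p
      by (simp add: s const sum_distrib_right[symmetric] cong: sum.cong)
  qed
qed

lemma inner_difference_cost:
  assumes "n0 \<le> m"
  shows "(\<Sum>n\<in>{n0..<m}. \<Sum>A\<in>inner n. \<Sum>B\<in>children n A. prob B *
        norm (interpolate L (dyadic_sum y) (state (Suc n) B) - interpolate L (dyadic_sum y) (state n A)) powr p) \<le>
      4 powr (2 - p) * (\<Sum>A\<in>inner m. prob A * state_cost p L y (state m A))"
  using assms
proof (induction m rule: dec_induct)
  case base
  then show ?case unfolding inner_start by (simp add: state_outside state_cost_def haar_potential_def)
next
  case (step m)
  have "(\<Sum>A\<in>inner m. \<Sum>B\<in>children m A. prob B *
        norm (interpolate L (dyadic_sum y) (state (Suc m) B) - interpolate L (dyadic_sum y) (state m A)) powr p) \<le>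
      (\<Sum>A\<in>inner m. 4 powr (2 - p) * ((\<Sum>B\<in>children m A. prob B * state_cost p L y (state (Suc m) B)) -
        prob A * state_cost p L y (state m A)))"
    using child_difference_cost[OF step.hyps(1)] by (intro sum_mono) blast
  also have "\<dots> = 4 powr (2 - p) * ((\<Sum>A\<in>inner (Suc m). prob A * state_cost p L y (state (Suc m) A)) -
      (\<Sum>A\<in>inner m. prob A * state_cost p L y (state m A)))"
    unfolding sum_inner_Suc[OF step.hyps(1)] by (simp only: sum_distrib_left[symmetric] sum_subtractf)
  finally show ?case using step by (simp add: right_diff_distrib)
qed

lemma newcomers_dichotomy:
  assumes "A \<in> At n" "i \<le> n" "\<omega> \<in> A"
  shows "\<omega> \<in> newcomers i \<longleftrightarrow> A \<subseteq> newcomers i"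
proof -
  have "newcomers i \<in> sets (F i)"
    unfolding newcomers_def using finite_At At_in_sets_F by (intro sets.finite_Union) auto
  then have "newcomers i \<in> sets (F n)" using sets_F_mono[OF assms(2)] by blast
  from At_dichotomy[OF this assms(1)] show ?thesis using assms(3) by blast
qed

definition atom_visits :: "nat \<Rightarrow> 'a set \<Rightarrow> nat" where
  "atom_visits n A = card {i \<in> {n0<..n}. A \<subseteq> newcomers i}"

lemma visits_eq_atom_visits: "A \<in> At n \<Longrightarrow> \<omega> \<in> A \<Longrightarrow> visits n0 n \<omega> = atom_visits n A"
  unfolding visits_def atom_visits_def
  by (rule arg_cong[where f = card]) (auto simp: newcomers_dichotomy[of A n _ \<omega>])

lemma atom_visits_child:
  assumes n: "n0 \<le> n" and A: "A \<in> At n" and B: "B \<in> children n A"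
  shows "atom_visits (Suc n) B = (if B = diamond ch n A then 0 else 1) + atom_visits n A"
proof -
  obtain \<omega> where \<omega>: "\<omega> \<in> B" using At_nonempty[OF child_At[OF B]] by blast
  then have "\<omega> \<in> A" using child_subset[OF B] by blast
  moreover have "\<omega> \<in> newcomers (Suc n) \<longleftrightarrow> B \<noteq> diamond ch n A"
  proof (cases "B = diamond ch n A")
    case True
    then have "B \<inter> newcomers (Suc n) = {}" unfolding child_newcomers[OF A B] by (rule if_P)
    then show ?thesis using True \<omega> by blast
  next
    case False
    then have "B \<inter> newcomers (Suc n) = B" unfolding child_newcomers[OF A B] by (rule if_not_P)
    then show ?thesis using False \<omega> by blast
  qed
  ultimately show ?thesis
    using visits_last[OF n, of \<omega>] visits_eq_atom_visits[OF child_At[OF B] \<omega>] visits_eq_atom_visits[OF A, of \<omega>]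
    by simp
qed

text \<open>
  A supermartingale along the paths of unfinished atoms: a visit to the collection multiplies it by
  \<open>3/2\<close> and a finished Haar function by \<open>1/3\<close>.
\<close>

definition weight :: "nat \<Rightarrow> 'a set \<Rightarrow> real" where
  "weight n A = (if fst (state n A) < L then (3/2) ^ atom_visits n A * (1/3) ^ fst (state n A) else 0)"

lemma weight_nonneg: "0 \<le> weight n A"
  by (simp add: weight_def)

lemma child_weight:
  assumes n: "n0 \<le> n" and A: "A \<in> At n" "A \<subseteq> I0"
  shows "(\<Sum>B\<in>children n A. prob B * weight (Suc n) B) \<le> prob A * weight n A"
proof -
  obtain j k v where s: "state n A = (j, k, v)" by (cases "state n A") auto
  note valid = state_valid[OF A(1) s]
  note child = state_child[OF n A _ s]
  show ?thesis
  proof (cases "j < L")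
    case True
    let ?w = "split n A v" and ?c = "(3/2) ^ atom_visits n A * (1/3::real) ^ j"
    let ?r = "\<lambda>B. (if B = diamond ch n A then 1 else 3/2) * (if \<bar>?w B\<bar> < 1 then 1 else 1/3::real)"
    have w: "(\<Sum>B\<in>children n A. prob B * ?r B) \<le> prob A"
      using good_split_split[OF A(1), of v] valid by (auto simp: good_split_def)
    have "prob B * weight (Suc n) B \<le> ?c * (prob B * ?r B)" if B: "B \<in> children n A" for B
    proof -
      have "weight (Suc n) B \<le> ?c * ?r B"
        using True atom_visits_child[OF n A(1) B]
        by (auto simp: weight_def child[OF B] move_def not_less)
      then have "prob B * weight (Suc n) B \<le> prob B * (?c * ?r B)"
        by (intro mult_left_mono) auto
      then show ?thesis by (simp only: mult.left_commute)
    qed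
    then have "(\<Sum>B\<in>children n A. prob B * weight (Suc n) B) \<le> ?c * (\<Sum>B\<in>children n A. prob B * ?r B)"
      unfolding sum_distrib_left by (rule sum_mono)
    also have "\<dots> \<le> ?c * prob A" using w by (intro mult_left_mono) auto
    finally show ?thesis using True by (simp add: weight_def s mult.commute)
  next
    case False
    then have "weight (Suc n) B = 0" if "B \<in> children n A" for B
      using that by (simp add: weight_def child move_def)
    then show ?thesis using weight_nonneg[of n A] by simp
  qed
qed

lemma inner_weight:
  assumes "n0 \<le> m"
  shows "(\<Sum>A\<in>inner m. prob A * weight m A) \<le> prob I0"
  using assms
proof (induction m rule: dec_induct)
  case base
  show ?case unfolding inner_start by (simp add: weight_def state_outside atom_visits_def)
next
  case (step m)
  have "(\<Sum>A\<in>inner (Suc m). prob A * weight (Suc m) A) \<le> (\<Sum>A\<in>inner m. prob A * weight m A)"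
    unfolding sum_inner_Suc[OF step.hyps(1)]
    using child_weight[OF step.hyps(1)] by (intro sum_mono) auto
  then show ?case using step.IH by simp
qed

definition unfinished :: "nat \<Rightarrow> real" where
  "unfinished m = (\<Sum>A\<in>inner m. if fst (state m A) < L then prob A else 0)"

text \<open>
  An unfinished atom has either few visits or weight at least \<open>(3/2)\<^sup>i / 3\<^sup>L\<close>, and the total mass
  of the weight is at most that of \<open>I0\<close>.
\<close>

lemma unfinished_le:
  assumes m: "n0 \<le> m"
  shows "unfinished m \<le> prob (I0 \<inter> {\<omega> \<in> space M. visits n0 m \<omega> < i}) + 3 ^ L * (2/3) ^ i * prob I0"
proof -
  let ?few = "{A \<in> inner m. atom_visits m A < i}"
  have "unfinished m \<le> (\<Sum>A\<in>inner m. (if atom_visits m A < i then prob A else 0) +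
      3 ^ L * (2/3) ^ i * (prob A * weight m A))"
    unfolding unfinished_def
  proof (rule sum_mono)
    fix A
    have "1 \<le> 3 ^ L * (2/3) ^ i * weight m A" if "fst (state m A) < L" "i \<le> atom_visits m A"
    proof -
      have "(1::real) = 3 ^ fst (state m A) * (1/3) ^ fst (state m A)"
        by (simp flip: power_mult_distrib)
      also have "\<dots> \<le> 3 ^ L * (1/3) ^ fst (state m A)"
        using that(1) by (intro mult_right_mono power_increasing) auto
      also have "\<dots> = 3 ^ L * (2/3) ^ i * ((3/2) ^ i * (1/3) ^ fst (state m A))"
        by (simp add: power_divide)
      also have "\<dots> \<le> 3 ^ L * (2/3) ^ i * weight m A"
        using that by (auto simp: weight_def intro!: mult_left_mono mult_right_mono power_increasing)
      finally show ?thesis .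
    qed
    then have "prob A * 1 \<le> prob A * (3 ^ L * (2/3) ^ i * weight m A)"
      if "fst (state m A) < L" "i \<le> atom_visits m A"
      using that by (intro mult_left_mono) auto
    then show "(if fst (state m A) < L then prob A else 0) \<le>
        (if atom_visits m A < i then prob A else 0) + 3 ^ L * (2/3) ^ i * (prob A * weight m A)"
      using weight_nonneg[of m A] by (auto simp: not_less algebra_simps)
  qed
  also have "\<dots> = sum prob ?few + 3 ^ L * (2/3) ^ i * (\<Sum>A\<in>inner m. prob A * weight m A)"
    unfolding sum.inter_filter[OF finite_inner] by (simp only: sum.distrib sum_distrib_left)
  also have "sum prob ?few = prob (\<Union>A\<in>?few. A)"
  proof (rule finite_measure_finite_Union[symmetric])
    show "disjoint_family_on (\<lambda>A. A) ?few"
      unfolding disjoint_family_on_def using At_disjoint[of _ m] by blast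
    show "finite ?few" by (rule finite_subset[OF _ finite_At[of m]]) blast
    show "(\<lambda>A. A) ` ?few \<subseteq> sets M" using At_in_sets[of _ m] by blast
  qed
  also have "\<dots> \<le> prob (I0 \<inter> {\<omega> \<in> space M. visits n0 m \<omega> < i})"
  proof (rule finite_measure_mono)
    show "(\<Union>A\<in>?few. A) \<subseteq> I0 \<inter> {\<omega> \<in> space M. visits n0 m \<omega> < i}"
    proof
      fix \<omega> assume "\<omega> \<in> (\<Union>A\<in>?few. A)"
      then obtain A where "A \<in> At m" "A \<subseteq> I0" "atom_visits m A < i" "\<omega> \<in> A" by auto
      then show "\<omega> \<in> I0 \<inter> {\<omega> \<in> space M. visits n0 m \<omega> < i}"
        using visits_eq_atom_visits[of A m \<omega>] At_subset[of A m] by auto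
    qed
    have [measurable]: "I0 \<in> sets M" using At_in_sets[OF I0] .
    show "I0 \<inter> {\<omega> \<in> space M. visits n0 m \<omega> < i} \<in> sets M" by measurable
  qed
  also have "3 ^ L * (2/3) ^ i * (\<Sum>A\<in>inner m. prob A * weight m A) \<le> 3 ^ L * (2/3) ^ i * prob I0"
    by (rule mult_left_mono[OF inner_weight[OF m]]) simp
  finally show ?thesis by simp
qed

definition finished_sum :: "nat \<Rightarrow> (nat \<Rightarrow> nat \<Rightarrow> real) \<Rightarrow> real" where
  "finished_sum m \<phi> = (\<Sum>A\<in>inner m. if fst (state m A) < L then 0 else prob A * \<phi> L (fst (snd (state m A))))"

text \<open>
  The conditional averages of \<open>\<phi>\<close> form a dyadic martingale with values in \<open>[0,b]\<close> that equals \<open>\<phi>\<close> in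
  final states.  Its mean is preserved, so the law of the final states differs from
  the uniform one only through the unfinished mass.
\<close>

lemma finished_sum_bounds:
  assumes m: "n0 \<le> m" and \<phi>: "\<And>k. k < 2 ^ L \<Longrightarrow> 0 \<le> \<phi> L k \<and> \<phi> L k \<le> b"
  shows "finished_sum m \<phi> \<le> prob I0 * dyadic_mean \<phi> L 0 0"
    and "prob I0 * dyadic_mean \<phi> L 0 0 \<le> finished_sum m \<phi> + b * unfinished m"
proof -
  define g where "g j = dyadic_mean \<phi> (L - j) j" for j
  have g: "dyadic_martingale L g" unfolding g_def by (rule dyadic_martingale_dyadic_mean)
  have total: "(\<Sum>A\<in>inner m. prob A * interpolate L g (state m A)) = prob I0 * dyadic_mean \<phi> L 0 0"
    using interpolate_inner_sum[OF m g] by (simp add: g_def)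
  have pointwise: "(if fst (state m A) < L then 0 else prob A * \<phi> L (fst (snd (state m A)))) \<le>
        prob A * interpolate L g (state m A) \<and>
      prob A * interpolate L g (state m A) \<le>
        (if fst (state m A) < L then 0 else prob A * \<phi> L (fst (snd (state m A)))) +
          b * (if fst (state m A) < L then prob A else 0)"
    if A: "A \<in> inner m" for A
  proof -
    obtain j k v where s: "state m A = (j, k, v)" by (cases "state m A") auto
    have valid: "j \<le> L" "k < 2 ^ j" "\<bar>v\<bar> < 1" using state_valid[of A m] A s by auto
    show ?thesis
    proof (cases "j < L")
      case True
      have node: "0 \<le> g (Suc j) i \<and> g (Suc j) i \<le> b" if "i < 2 ^ Suc j" for i
        unfolding g_def using True \<phi> that by (intro dyadic_mean_bounds) auto
      have n: "0 \<le> g (Suc j) (2 * k)" "g (Suc j) (2 * k) \<le> b" "0 \<le> g (Suc j) (2 * k + 1)" "g (Suc j) (2 * k + 1) \<le> b"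
        using node[of "2 * k"] node[of "2 * k + 1"] valid by auto
      define x where "x = interpolate L g (state m A)"
      have x: "x = (1 + v) / 2 * g (Suc j) (2 * k) + (1 - v) / 2 * g (Suc j) (2 * k + 1)"
        using True by (simp add: x_def s interpolate_def)
      have "0 \<le> x" unfolding x using n valid by (intro add_nonneg_nonneg mult_nonneg_nonneg) auto
      moreover have "x \<le> (1 + v) / 2 * b + (1 - v) / 2 * b"
        unfolding x using n valid by (intro add_mono mult_left_mono) auto
      then have "x \<le> b" by (simp add: field_simps)
      ultimately have "0 \<le> prob A * x" "prob A * x \<le> prob A * b"
        by (auto intro: mult_left_mono)
      then show ?thesis using True unfolding x_def by (simp add: s mult.commute)
    next
      case False
      then show ?thesis using valid by (simp add: s interpolate_def g_def)
    qed
  qed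
  show "finished_sum m \<phi> \<le> prob I0 * dyadic_mean \<phi> L 0 0"
    unfolding finished_sum_def total[symmetric] using pointwise by (intro sum_mono) blast
  show "prob I0 * dyadic_mean \<phi> L 0 0 \<le> finished_sum m \<phi> + b * unfinished m"
    unfolding finished_sum_def unfinished_def total[symmetric] sum_distrib_left sum.distrib[symmetric]
    using pointwise by (intro sum_mono) blast
qed

lemma state_outside_child:
  assumes "n < n0 \<or> \<not> A \<subseteq> I0" and A: "A \<in> At n" and B: "B \<in> children n A"
  shows "state n A = (0, 0, 0)" "state (Suc n) B = (0, 0, 0)"
proof -
  show "state n A = (0, 0, 0)" using assms(1) by (intro state_outside) auto
  show "state (Suc n) B = (0, 0, 0)"
  proof (cases "n < n0")
    case False
    then have "A \<inter> I0 = {}" using assms(1) At_dichotomy_le[OF I0 A] by auto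
    moreover have "B \<subseteq> A" "B \<noteq> {}" using child_subset[OF B] At_nonempty[OF child_At[OF B]] by auto
    ultimately show ?thesis by (intro state_outside) auto
  qed (intro state_outside, simp)
qed

text \<open>
  The inequality for finite martingales, applied to the copy of the Haar sum.  Its last value is
  the Haar sum itself on finished atoms, its increments cost at most \<open>4\<^bsup>2-p\<^esup>\<close> times the accumulated
  state cost, and unfinished atoms enter through the bounds \<open>b\<close> and \<open>c\<close>.
\<close>

lemma embedded_inequality:
  fixes y :: "nat \<Rightarrow> nat \<Rightarrow> 'b::banach"
  assumes m: "n0 \<le> m" and T: "0 < T"
    and hyp: "\<And>f :: 'a \<Rightarrow> 'b. f \<in> Lp_space p M \<Longrightarrow>
           Lp_norm p M f \<le> ennreal T *
             enn_powr (enn_powr (Lp_norm p M (cond_exp M (F 0) f)) p +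
               (\<Sum>n. enn_powr (Lp_norm p M
                  (\<lambda>\<omega>. cond_exp M (F (Suc n)) f \<omega> - cond_exp M (F n) f \<omega>)) p)) (1 / p)"
    and b: "\<And>k. k < 2 ^ L \<Longrightarrow> norm (dyadic_sum y L k) powr p \<le> b"
    and c: "\<And>j k. j \<le> L \<Longrightarrow> k < 2 ^ j \<Longrightarrow> dyadic_cost p y j k + norm (y j k) powr p \<le> c"
  shows "prob I0 * dyadic_mean (\<lambda>j k. norm (dyadic_sum y j k) powr p) L 0 0 \<le>
    T powr p * 4 powr (2 - p) * (prob I0 * dyadic_mean (dyadic_cost p y) L 0 0) +
    (b + T powr p * 4 powr (2 - p) * c) * unfinished m"
proof -
  define f where "f n A = interpolate L (dyadic_sum y) (state n A)" for n A
  let ?\<phi> = "\<lambda>j k. norm (dyadic_sum y j k) powr p"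
  let ?d = "\<lambda>n A. \<Sum>B\<in>children n A. prob B * norm (f (Suc n) B - f n A) powr p"
  have cost_nonneg: "0 \<le> dyadic_cost p y j k" for j k
    by (induction j arbitrary: k) auto
  have f0: "f n A = 0" if "state n A = (0, 0, 0)" for n A
    using interpolate_start[OF dyadic_martingale_dyadic_sum, of L y 0 0] that by (simp add: f_def)
  have outside: "f n A = 0 \<and> (\<forall>B\<in>children n A. f (Suc n) B = 0)"
    if "n < n0 \<or> \<not> A \<subseteq> I0" "A \<in> At n" for n A
    using f0 state_outside_child[OF that] children_nonempty[OF that(2)] by blast
  have mart: "(\<Sum>B\<in>children n A. prob B *\<^sub>R f (Suc n) B) = prob A *\<^sub>R f n A" if A: "A \<in> At n" for n A
  proof (cases "n0 \<le> n \<and> A \<subseteq> I0")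
    case True
    then show ?thesis unfolding f_def using A dyadic_martingale_dyadic_sum by (intro interpolate_child_sum) auto
  next
    case False
    then have "n < n0 \<or> \<not> A \<subseteq> I0" by (simp only: de_Morgan_conj not_le)
    from outside[OF this A] show ?thesis by simp
  qed
  have "finished_sum m ?\<phi> \<le> (\<Sum>A\<in>inner m. prob A * norm (f m A) powr p)"
    unfolding finished_sum_def
  proof (rule sum_mono)
    fix A assume "A \<in> inner m"
    obtain j k v where s: "state m A = (j, k, v)" by (cases "state m A") auto
    then have "j \<le> L" using state_valid[of A m] \<open>A \<in> inner m\<close> by auto
    then show "(if fst (state m A) < L then 0 else prob A * ?\<phi> L (fst (snd (state m A)))) \<le>
        prob A * norm (f m A) powr p"
      by (auto simp: f_def s interpolate_def)
  qed
  also have "\<dots> \<le> (\<Sum>A\<in>At m. prob A * norm (f m A) powr p)"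
    using finite_At by (intro sum_mono2) auto
  also have "\<dots> \<le> T powr p * (\<Sum>n<m. \<Sum>A\<in>At n. ?d n A)"
  proof (rule finite_martingale_inequality[OF _ T hyp])
    show "(\<Sum>B\<in>children k A. prob B *\<^sub>R f (Suc k) B) = prob A *\<^sub>R f k A" if "A \<in> At k" for k A
      using mart[OF that] .
    show "f 0 (space M) = 0" by (rule f0) simp
  qed (use p in auto)
  also have "(\<Sum>n<m. \<Sum>A\<in>At n. ?d n A) = (\<Sum>n\<in>{n0..<m}. \<Sum>A\<in>inner n. ?d n A)"
  proof -
    have zero: "?d n A = 0" if "n < n0 \<or> \<not> A \<subseteq> I0" "A \<in> At n" for n A
      using outside[OF that] by (intro sum.neutral) simp
    have "(\<Sum>n<m. \<Sum>A\<in>At n. ?d n A) = (\<Sum>n\<in>{n0..<m}. \<Sum>A\<in>At n. ?d n A)"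
    proof (intro sum.mono_neutral_right ballI)
      fix n assume "n \<in> {..<m} - {n0..<m}"
      then have "n < n0 \<or> \<not> A \<subseteq> I0" for A by auto
      then show "(\<Sum>A\<in>At n. ?d n A) = 0" by (intro sum.neutral ballI zero)
    qed auto
    also have "\<dots> = (\<Sum>n\<in>{n0..<m}. \<Sum>A\<in>inner n. ?d n A)"
    proof (rule sum.cong[OF refl])
      fix n
      show "(\<Sum>A\<in>At n. ?d n A) = (\<Sum>A\<in>inner n. ?d n A)"
      proof (intro sum.mono_neutral_right ballI finite_At)
        fix A assume "A \<in> At n - inner n"
        then show "?d n A = 0" by (intro zero) auto
      qed auto
    qed
    finally show ?thesis .
  qed
  also have "\<dots> \<le> 4 powr (2 - p) * (\<Sum>A\<in>inner m. prob A * state_cost p L y (state m A))"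
    unfolding f_def by (rule inner_difference_cost[OF m])
  also have "(\<Sum>A\<in>inner m. prob A * state_cost p L y (state m A)) \<le>
      finished_sum m (dyadic_cost p y) + c * unfinished m"
    unfolding finished_sum_def unfinished_def sum_distrib_left sum.distrib[symmetric]
  proof (rule sum_mono)
    fix A assume "A \<in> inner m"
    obtain j k v where s: "state m A = (j, k, v)" by (cases "state m A") auto
    then have valid: "j \<le> L" "k < 2 ^ j" "\<bar>v\<bar> < 1" using state_valid[of A m] \<open>A \<in> inner m\<close> by auto
    show "prob A * state_cost p L y (state m A) \<le>
        (if fst (state m A) < L then 0 else prob A * dyadic_cost p y L (fst (snd (state m A)))) +
        c * (if fst (state m A) < L then prob A else 0)"
    proof (cases "j < L")
      case True
      have "v\<^sup>2 \<le> 1" using valid(3) by (simp add: abs_square_le_1)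
      then have "p / 2 * v\<^sup>2 \<le> 1 * 1" using p by (intro mult_mono) auto
      then have "haar_potential p v * norm (y j k) powr p \<le> 1 * norm (y j k) powr p"
        using valid(3) by (intro mult_right_mono) (auto simp: haar_potential_def)
      then have "state_cost p L y (j, k, v) \<le> c"
        using c[OF valid(1,2)] True by (simp add: state_cost_def)
      then show ?thesis using True by (simp add: s mult.commute[of c] mult_left_mono)
    next
      case False
      then show ?thesis using valid by (simp add: s state_cost_def)
    qed
  qed
  also have "finished_sum m (dyadic_cost p y) \<le> prob I0 * dyadic_mean (dyadic_cost p y) L 0 0"
  proof (rule finished_sum_bounds(1)[OF m, where b = c])
    fix k :: nat assume "k < 2 ^ L"
    then show "0 \<le> dyadic_cost p y L k \<and> dyadic_cost p y L k \<le> c"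
      using c[OF order_refl, of k] cost_nonneg[of L k] powr_ge_zero[of "norm (y L k)" p] by linarith
  qed
  finally have upper: "finished_sum m ?\<phi> \<le> T powr p * (4 powr (2 - p) *
      (prob I0 * dyadic_mean (dyadic_cost p y) L 0 0 + c * unfinished m))"
    by (simp add: mult_left_mono)
  have "prob I0 * dyadic_mean ?\<phi> L 0 0 \<le> finished_sum m ?\<phi> + b * unfinished m"
    using b by (intro finished_sum_bounds(2)[OF m]) auto
  with upper show ?thesis by (simp add: algebra_simps)
qed

end

text \<open>
  For a given Haar sum the bounds \<open>b\<close> and \<open>c\<close> are fixed, whereas the relative unfinished mass can be made
  arbitrarily small by starting in an atom with many visits.
\<close>

lemma (in atomic_filtration) dyadic_inequality:
  fixes y :: "nat \<Rightarrow> nat \<Rightarrow> 'b::banach"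
  assumes infinite: "carleson_constant M (coll_E At ch) = \<infinity>"
    and p: "1 < p" "p \<le> 2" and T: "0 < T"
    and hyp: "\<And>f :: 'a \<Rightarrow> 'b. f \<in> Lp_space p M \<Longrightarrow>
           Lp_norm p M f \<le> ennreal T *
             enn_powr (enn_powr (Lp_norm p M (cond_exp M (F 0) f)) p +
               (\<Sum>n. enn_powr (Lp_norm p M
                  (\<lambda>\<omega>. cond_exp M (F (Suc n)) f \<omega> - cond_exp M (F n) f \<omega>)) p)) (1 / p)"
  shows "dyadic_mean (\<lambda>j k. norm (dyadic_sum y j k) powr p) L 0 0 \<le>
    T powr p * 4 powr (2 - p) * dyadic_mean (dyadic_cost p y) L 0 0"
proof -
  let ?X = "dyadic_mean (\<lambda>j k. norm (dyadic_sum y j k) powr p) L 0 0"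
  let ?Y = "dyadic_mean (dyadic_cost p y) L 0 0"
  define K where "K = T powr p * 4 powr (2 - p)"
  define b where "b = Max ((\<lambda>k. norm (dyadic_sum y L k) powr p) ` {..<2 ^ L})"
  define c where "c = Max ((\<lambda>(j, k). dyadic_cost p y j k + norm (y j k) powr p) ` (SIGMA j:{..L}. {..<2 ^ j}))"
  have b: "norm (dyadic_sum y L k) powr p \<le> b" if "k < 2 ^ L" for k
    unfolding b_def using that by (intro Max_ge) auto
  have c: "dyadic_cost p y j k + norm (y j k) powr p \<le> c" if "j \<le> L" "k < 2 ^ j" for j k
    unfolding c_def using that by (intro Max_ge) force+
  have b0: "0 \<le> b" by (rule order_trans[OF powr_ge_zero b[of 0]]) simp
  have c0: "0 \<le> c" using order_trans[OF powr_ge_zero, of "norm (y 0 0)" p c] c[of 0 0] by simp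
  have K0: "0 \<le> K" by (simp add: K_def)
  have approx: "?X \<le> K * ?Y + (b + K * c) * \<delta>" if \<delta>: "0 < \<delta>" "\<delta> \<le> 1" for \<delta>
  proof -
    \<comment> \<open>so many visits that the unfinished atoms among those with at least \<open>i\<close> visits are negligible\<close>
    obtain i where i: "(2/3) ^ i < \<delta> / 2 / 3 ^ L"
      using real_arch_pow_inv[of "\<delta> / 2 / 3 ^ L" "2/3"] \<delta> by auto
    obtain n m I where I: "n \<le> m" "I \<in> At n"
      "prob (I \<inter> {\<omega> \<in> space M. visits n m \<omega> < i}) \<le> \<delta> / 2 * prob I"
      using exists_rich_atom[OF infinite, of "\<delta> / 2" i] \<delta> by auto
    interpret haar_embedding M F At ch p L n I
      using p I(2) by unfold_locales
    have pos: "0 < prob I" using prob_At[OF I(2)] .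
    have "3 ^ L * (2/3) ^ i \<le> \<delta> / 2" using i by (simp add: field_simps)
    then have "3 ^ L * (2/3) ^ i * prob I \<le> \<delta> / 2 * prob I" by (intro mult_right_mono) auto
    then have "unfinished m \<le> \<delta> * prob I"
      using unfinished_le[OF I(1), of i] I(3) by simp
    then have "(b + K * c) * unfinished m \<le> (b + K * c) * (\<delta> * prob I)"
      using b0 c0 K0 by (intro mult_left_mono) auto
    moreover have "prob I * ?X \<le> K * (prob I * ?Y) + (b + K * c) * unfinished m"
      unfolding K_def by (rule embedded_inequality[OF I(1) T hyp b c])
    ultimately have "prob I * ?X \<le> prob I * (K * ?Y + (b + K * c) * \<delta>)" by (simp add: algebra_simps)
    then show ?thesis using pos by simp
  qed
  have "?X \<le> K * ?Y + e" if e: "0 < e" for e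
  proof -
    define \<delta> where "\<delta> = min 1 (e / (b + K * c + 1))"
    have q: "0 < b + K * c + 1" using b0 c0 K0 by (simp add: add_nonneg_pos)
    have \<delta>: "0 < \<delta>" "\<delta> \<le> 1" using e q by (auto simp: \<delta>_def)
    have "(b + K * c) * \<delta> \<le> (b + K * c + 1) * (e / (b + K * c + 1))"
      using b0 c0 K0 \<delta> e q by (intro mult_mono) (auto simp: \<delta>_def)
    also have "\<dots> = e" using q by simp
    finally show ?thesis using approx[OF \<delta>] by linarith
  qed
  then show ?thesis unfolding K_def[symmetric] by (rule field_le_epsilon)
qed

section \<open>Haar series on the unit interval\<close>

lemma sum_double:
  fixes h :: "nat \<Rightarrow> 'c::comm_monoid_add"
  shows "(\<Sum>k<2 * n. h k) = (\<Sum>k<n. h (2 * k) + h (2 * k + 1))"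
  by (induction n) (auto simp: add.assoc)

lemma dyadic_mean_eq_average: "dyadic_mean \<phi> L 0 0 = (\<Sum>k<2 ^ L. \<phi> L k) / 2 ^ L"
proof -
  have "(\<Sum>k<2 ^ j. dyadic_mean \<phi> n j k) * 2 ^ n = (\<Sum>k<2 ^ (j + n). \<phi> (j + n) k)" for j n
  proof (induction n arbitrary: j)
    case (Suc n)
    have "(\<Sum>k<2 ^ j. dyadic_mean \<phi> (Suc n) j k) * 2 ^ Suc n =
        (\<Sum>k<2 ^ j. dyadic_mean \<phi> n (Suc j) (2 * k) + dyadic_mean \<phi> n (Suc j) (2 * k + 1)) * 2 ^ n"
      by (simp add: sum_divide_distrib[symmetric])
    also have "\<dots> = (\<Sum>k<2 ^ Suc j. dyadic_mean \<phi> n (Suc j) k) * 2 ^ n"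
      by (simp only: power_Suc sum_double)
    finally show ?case using Suc.IH[of "Suc j"] by (simp only: add_Suc_right add_Suc)
  qed simp
  from this[of L 0] have "dyadic_mean \<phi> L 0 0 * 2 ^ L = (\<Sum>k<2 ^ L. \<phi> L k)"
    by (simp add: lessThan_Suc)
  then show ?thesis by (simp add: eq_divide_eq)
qed

text \<open>
  Each interval of generation \<open>j\<close> is passed by a fraction \<open>1/2\<^sup>j\<close> of all paths of length \<open>L\<close>.
\<close>

lemma dyadic_mean_cost:
  "dyadic_mean (dyadic_cost p y) L 0 0 = (\<Sum>j<L. \<Sum>i<2 ^ j. norm (y j i) powr p / 2 ^ j)"
proof (induction L)
  case (Suc L)
  have "(\<Sum>k<2 ^ Suc L. dyadic_cost p y (Suc L) k) =
      (\<Sum>k<2 ^ L. 2 * (dyadic_cost p y L k + norm (y L k) powr p))"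
    unfolding power_Suc sum_double by (intro sum.cong) auto
  also have "\<dots> = 2 * (\<Sum>k<2 ^ L. dyadic_cost p y L k) + 2 * (\<Sum>k<2 ^ L. norm (y L k) powr p)"
    by (simp only: sum.distrib sum_distrib_left distrib_left)
  finally show ?case
    using Suc.IH unfolding dyadic_mean_eq_average by (simp add: add_divide_distrib sum_divide_distrib)
qed simp

definition dyadic :: "nat \<Rightarrow> nat \<Rightarrow> real set" where
  "dyadic j k = {real k / 2 ^ j ..< (real k + 1) / 2 ^ j}"

lemma dyadic_intervals_eq: "dyadic_intervals = {dyadic j k |j k. k < 2 ^ j}"
  unfolding dyadic_intervals_def dyadic_def by blast

lemma dyadic_nonempty: "real k / 2 ^ j < (real k + 1) / 2 ^ j"
  by (simp add: divide_strict_right_mono)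

lemma Inf_dyadic: "Inf (dyadic j k) = real k / 2 ^ j"
  and Sup_dyadic: "Sup (dyadic j k) = (real k + 1) / 2 ^ j"
  using dyadic_nonempty unfolding dyadic_def by (auto intro: cInf_atLeastLessThan cSup_atLeastLessThan)

lemma measure_dyadic: "measure lborel (dyadic j k) = 1 / 2 ^ j"
  unfolding dyadic_def using dyadic_nonempty[of k j] by (simp add: diff_divide_distrib[symmetric])

lemma emeasure_dyadic: "emeasure lborel (dyadic j k) = ennreal (1 / 2 ^ j)"
  unfolding dyadic_def using dyadic_nonempty[of k j] by (simp add: diff_divide_distrib[symmetric])

lemma dyadic_inject: "dyadic j k = dyadic j' k' \<longleftrightarrow> j = j' \<and> k = k'"
proof
  assume eq: "dyadic j k = dyadic j' k'"
  have "1 / 2 ^ j = (1 / 2 ^ j' :: real)" using measure_dyadic[of j k] measure_dyadic[of j' k'] eq by simp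
  then have "j = j'" by simp
  moreover have "real k / 2 ^ j = real k' / 2 ^ j'" using Inf_dyadic[of j k] Inf_dyadic[of j' k'] eq by simp
  ultimately show "j = j' \<and> k = k'" by simp
qed simp

lemma left_half_dyadic: "left_half (dyadic j k) = dyadic (Suc j) (2 * k)"
  and right_half_dyadic: "right_half (dyadic j k) = dyadic (Suc j) (2 * k + 1)"
  unfolding left_half_def right_half_def Inf_dyadic Sup_dyadic
  by (auto simp: dyadic_def field_simps)

lemma dyadic_mem: "t \<in> dyadic j k \<longleftrightarrow> real k \<le> t * 2 ^ j \<and> t * 2 ^ j < real k + 1"
  unfolding dyadic_def by (auto simp: field_simps)

lemma dyadic_disjoint:
  assumes "t \<in> dyadic j k" "t \<in> dyadic j k'"
  shows "k = k'"
  using assms unfolding dyadic_mem by linarith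

lemma dyadic_parent: "t \<in> dyadic (Suc j) k \<Longrightarrow> t \<in> dyadic j (k div 2)"
proof -
  assume t: "t \<in> dyadic (Suc j) k"
  have "k = 2 * (k div 2) + k mod 2" "k mod 2 < 2" by auto
  then have "real k = 2 * real (k div 2) + real (k mod 2)" "real (k mod 2) \<le> 1" by linarith+
  with t show ?thesis by (auto simp: dyadic_mem)
qed

lemma dyadic_exists:
  assumes "0 \<le> t" "t < 1"
  shows "\<exists>k<2 ^ L. t \<in> dyadic L k"
proof -
  define k where "k = nat \<lfloor>t * 2 ^ L\<rfloor>"
  have "0 \<le> t * 2 ^ L" "t * 2 ^ L < 2 ^ L" using assms by auto
  then have "real k = of_int \<lfloor>t * 2 ^ L\<rfloor>" by (simp add: k_def)
  then have "real k \<le> t * 2 ^ L" "t * 2 ^ L < real k + 1" by linarith+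
  moreover from this have "real k < 2 ^ L" using \<open>t * 2 ^ L < 2 ^ L\<close> by linarith
  then have "k < 2 ^ L" by (metis of_nat_less_iff of_nat_numeral of_nat_power)
  ultimately show ?thesis by (auto simp: dyadic_mem)
qed

lemma dyadic_subset_unit: "k < 2 ^ L \<Longrightarrow> dyadic L k \<subseteq> {0..<1}"
proof
  fix t assume k: "k < 2 ^ L" and t: "t \<in> dyadic L k"
  have "real (k + 1) \<le> real (2 ^ L)" using k by (intro of_nat_mono) simp
  then have "real k + 1 \<le> 2 ^ L" by simp
  moreover have "real k \<le> t * 2 ^ L" "t * 2 ^ L < real k + 1" using t by (auto simp: dyadic_mem)
  ultimately have "t * 2 ^ L < 1 * 2 ^ L" "0 \<le> t * 2 ^ L" by linarith+
  then have "t < 1" "0 \<le> t"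
    using mult_less_cancel_right_pos[of "2 ^ L" t 1] mult_neg_pos[of t "2 ^ L"] by (auto simp: not_less[symmetric])
  then show "t \<in> {0..<1}" by (simp add: zero_le_mult_iff)
qed

lemma haar_dyadic: "haar (dyadic j k) t = indicator (dyadic (Suc j) (2 * k)) t - indicator (dyadic (Suc j) (2 * k + 1)) t"
  unfolding haar_def left_half_dyadic right_half_dyadic ..

lemma haar_sum_on_dyadic:
  fixes y :: "nat \<Rightarrow> nat \<Rightarrow> 'b::real_vector"
  assumes "k < 2 ^ L" "t \<in> dyadic L k"
  shows "(\<Sum>j<L. \<Sum>i<2 ^ j. haar (dyadic j i) t *\<^sub>R y j i) = dyadic_sum y L k"
  using assms
proof (induction L arbitrary: k)
  case (Suc L)
  have k: "k div 2 < 2 ^ L" using Suc.prems(1) by auto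
  have t: "t \<in> dyadic L (k div 2)" using dyadic_parent[OF Suc.prems(2)] .
  have other: "haar (dyadic L i) t = (if i = k div 2 then if even k then 1 else - 1 else 0)" for i
  proof -
    have "t \<in> dyadic (Suc L) i' \<longleftrightarrow> i' = k" for i'
      using dyadic_disjoint[OF Suc.prems(2)] Suc.prems(2) by blast
    moreover have "2 * i = k \<longleftrightarrow> i = k div 2 \<and> even k" "2 * i + 1 = k \<longleftrightarrow> i = k div 2 \<and> odd k"
      by presburger+
    ultimately show ?thesis unfolding haar_dyadic indicator_def by simp
  qed
  have "(\<Sum>i<2 ^ L. haar (dyadic L i) t *\<^sub>R y L i) =
      (\<Sum>i<2 ^ L. if i = k div 2 then (if even k then y L i else - y L i) else 0)"
    unfolding other by (intro sum.cong) auto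
  also have "\<dots> = (if even k then y L (k div 2) else - y L (k div 2))"
    using k by simp
  finally show ?case using Suc.IH[OF k t] by simp
qed simp

lemma nn_integral_unit_dyadic:
  fixes h :: "real \<Rightarrow> real"
  assumes h: "\<And>t k. k < 2 ^ L \<Longrightarrow> t \<in> dyadic L k \<Longrightarrow> h t = c k" and c: "\<And>k. 0 \<le> c k"
  shows "(\<integral>\<^sup>+t. ennreal (h t) \<partial>unit_measure) = ennreal ((\<Sum>k<2 ^ L. c k) / 2 ^ L)"
proof -
  have "(\<integral>\<^sup>+t. ennreal (h t) \<partial>unit_measure) = (\<integral>\<^sup>+t. ennreal (h t) * indicator {0..<1} t \<partial>lborel)"
    by (subst nn_integral_restrict_space) auto
  also have "\<dots> = (\<integral>\<^sup>+t. (\<Sum>k<2 ^ L. ennreal (c k) * indicator (dyadic L k) t) \<partial>lborel)"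
  proof (rule nn_integral_cong)
    fix t :: real
    show "ennreal (h t) * indicator {0..<1} t = (\<Sum>k<2 ^ L. ennreal (c k) * indicator (dyadic L k) t)"
    proof (cases "t \<in> {0..<1}")
      case True
      then obtain k where k: "k < 2 ^ L" "t \<in> dyadic L k" using dyadic_exists[of t L] by auto
      have "(\<Sum>i<2 ^ L. ennreal (c i) * indicator (dyadic L i) t) = (\<Sum>i<2 ^ L. if i = k then ennreal (c i) else 0)"
      proof (rule sum.cong[OF refl])
        fix i
        show "ennreal (c i) * indicator (dyadic L i) t = (if i = k then ennreal (c i) else 0)"
          using k(2) dyadic_disjoint[OF k(2), of i] by (cases "t \<in> dyadic L i") auto
      qed
      then show ?thesis using True k h[OF k] by simp
    next
      case False
      then have "t \<notin> dyadic L k" if "k < 2 ^ L" for k using dyadic_subset_unit[OF that] by blast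
      then show ?thesis using False by simp
    qed
  qed
  also have "\<dots> = (\<Sum>k<2 ^ L. ennreal (c k) * emeasure lborel (dyadic L k))"
    by (subst nn_integral_sum) (auto simp: nn_integral_cmult_indicator dyadic_def)
  also have "\<dots> = (\<Sum>k<2 ^ L. ennreal (c k / 2 ^ L))"
    using c by (intro sum.cong) (auto simp: emeasure_dyadic ennreal_mult''[symmetric])
  also have "\<dots> = ennreal ((\<Sum>k<2 ^ L. c k) / 2 ^ L)"
    using c by (subst sum_ennreal) (auto simp: sum_divide_distrib)
  finally show ?thesis .
qed

text \<open>
  Coefficients that vanish outside \<open>D\<close> turn the sum over \<open>D\<close> into one over all generations below some
  \<open>L\<close>, which is constant on the dyadic intervals of generation \<open>L\<close>.
\<close>

lemma finite_haar_inequality: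
  fixes x :: "real set \<Rightarrow> 'b::real_normed_vector"
  assumes node: "\<And>L (y :: nat \<Rightarrow> nat \<Rightarrow> 'b).
      dyadic_mean (\<lambda>j k. norm (dyadic_sum y j k) powr p) L 0 0 \<le> K * dyadic_mean (dyadic_cost p y) L 0 0"
    and D: "finite D" "D \<subseteq> dyadic_intervals"
  shows "(\<integral>\<^sup>+t. ennreal (norm (\<Sum>I\<in>D. haar I t *\<^sub>R x I) powr p) \<partial>unit_measure) \<le>
    ennreal (K * (\<Sum>I\<in>D. norm (x I) powr p * measure lborel I))"
proof -
  define y where "y j k = (if dyadic j k \<in> D then x (dyadic j k) else 0)" for j k
  have "\<forall>I\<in>D. \<exists>j k. k < 2 ^ j \<and> I = dyadic j k" using D(2) unfolding dyadic_intervals_eq by blast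
  then obtain lev pos where lp: "\<And>I. I \<in> D \<Longrightarrow> pos I < 2 ^ lev I \<and> I = dyadic (lev I) (pos I)" by metis
  define L where "L = Suc (Max (insert 0 (lev ` D)))"
  have lev: "lev I < L" if "I \<in> D" for I
    using D(1) that by (auto simp: L_def less_Suc_eq_le)
  have reindex: "(\<Sum>I\<in>D. H I) = (\<Sum>j<L. \<Sum>i<2 ^ j. if dyadic j i \<in> D then H (dyadic j i) else 0)"
    for H :: "real set \<Rightarrow> 'c::comm_monoid_add"
  proof -
    let ?S = "SIGMA j:{..<L}. {..<2 ^ j}"
    have inj: "inj_on (\<lambda>(j, i). dyadic j i) ?S" by (auto simp: inj_on_def dyadic_inject)
    have "(\<Sum>j<L. \<Sum>i<2 ^ j. if dyadic j i \<in> D then H (dyadic j i) else 0) =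
        (\<Sum>q\<in>?S. if (\<lambda>(j, i). dyadic j i) q \<in> D then H ((\<lambda>(j, i). dyadic j i) q) else 0)"
      by (subst sum.Sigma) (auto intro!: sum.cong)
    also have "\<dots> = (\<Sum>I\<in>(\<lambda>(j, i). dyadic j i) ` ?S. if I \<in> D then H I else 0)"
      using inj by (subst sum.reindex) (auto simp: comp_def)
    also have "\<dots> = (\<Sum>I\<in>D. if I \<in> D then H I else 0)"
    proof (rule sum.mono_neutral_right)
      show "D \<subseteq> (\<lambda>(j, i). dyadic j i) ` ?S"
      proof
        fix I assume I: "I \<in> D"
        have "(lev I, pos I) \<in> ?S" using lp[OF I] lev[OF I] by simp
        then show "I \<in> (\<lambda>(j, i). dyadic j i) ` ?S" using lp[OF I] by (metis (mono_tags, lifting) case_prod_conv image_eqI)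
      qed
    qed auto
    finally show ?thesis by simp
  qed
  have sum_eq: "(\<Sum>I\<in>D. haar I t *\<^sub>R x I) = dyadic_sum y L k" if "k < 2 ^ L" "t \<in> dyadic L k" for t k
    unfolding haar_sum_on_dyadic[OF that, symmetric] reindex by (intro sum.cong) (auto simp: y_def)
  have "(\<integral>\<^sup>+t. ennreal (norm (\<Sum>I\<in>D. haar I t *\<^sub>R x I) powr p) \<partial>unit_measure) =
      ennreal ((\<Sum>k<2 ^ L. norm (dyadic_sum y L k) powr p) / 2 ^ L)"
    by (rule nn_integral_unit_dyadic) (auto simp: sum_eq)
  also have "(\<Sum>k<2 ^ L. norm (dyadic_sum y L k) powr p) / 2 ^ L =
      dyadic_mean (\<lambda>j k. norm (dyadic_sum y j k) powr p) L 0 0"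
    by (simp add: dyadic_mean_eq_average)
  also have "ennreal \<dots> \<le> ennreal (K * dyadic_mean (dyadic_cost p y) L 0 0)"
    by (rule ennreal_leI[OF node])
  also have "dyadic_mean (dyadic_cost p y) L 0 0 = (\<Sum>I\<in>D. norm (x I) powr p * measure lborel I)"
    unfolding dyadic_mean_cost reindex by (intro sum.cong) (auto simp: y_def measure_dyadic)
  finally show ?thesis .
qed

text \<open>
  Convexity of \<open>z \<mapsto> z\<^sup>p\<close> at the points \<open>a/l\<close> and \<open>b/(1-l)\<close>.  For \<open>l\<close> close to \<open>1\<close> the factor of
  \<open>a\<^sup>p\<close> is close to \<open>1\<close>, so this replaces Minkowski's inequality in limit arguments.
\<close>

lemma powr_add_le_weighted:
  fixes a b l p :: real
  assumes "0 \<le> a" "0 \<le> b" "0 < l" "l < 1" "1 < p"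
  shows "(a + b) powr p \<le> l powr (1 - p) * a powr p + (1 - l) powr (1 - p) * b powr p"
proof -
  have weight: "r * (z / r) powr p = r powr (1 - p) * z powr p" if "0 < r" "0 \<le> z" for r z :: real
    using that by (simp add: powr_divide powr_diff)
  have pw: "0 \<le> s powr (1 - p) * z powr p" for s z :: real by simp
  consider "a = 0" | "b = 0" | "0 < a" "0 < b" using assms by fastforce
  then show ?thesis
  proof cases
    case 1
    have "1 powr (p - 1) * b powr p \<le> (1 - l) powr (1 - p) * b powr p"
      using powr_mono2'[of "1 - p" "1 - l" 1] assms by (intro mult_right_mono) auto
    then show ?thesis using 1 assms by simp
  next
    case 2
    have "1 powr (p - 1) * a powr p \<le> l powr (1 - p) * a powr p"
      using powr_mono2'[of "1 - p" l 1] assms by (intro mult_right_mono) auto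
    then show ?thesis using 2 assms by simp
  next
    case 3
    have "(l *\<^sub>R (a / l) + (1 - l) *\<^sub>R (b / (1 - l))) powr p \<le>
        l * (a / l) powr p + (1 - l) * (b / (1 - l)) powr p"
      using convex_onD[OF powr_convex, of p "1 - l" "a / l" "b / (1 - l)"] 3 assms by simp
    then show ?thesis using weight[of l a] weight[of "1 - l" b] assms by simp
  qed
qed

lemma strongly_measurable_norm:
  fixes g :: "'a \<Rightarrow> 'b::banach"
  assumes "strongly_measurable M g"
  shows "(\<lambda>t. norm (g t)) \<in> borel_measurable M"
proof -
  from assms obtain s where s: "\<And>i. simple_function M (s i)" "\<And>t. t \<in> space M \<Longrightarrow> (\<lambda>i. s i t) \<longlonglongrightarrow> g t"
    unfolding strongly_measurable_def by blast
  show ?thesis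
  proof (rule borel_measurable_LIMSEQ_real)
    show "(\<lambda>t. norm (s i t)) \<in> borel_measurable M" for i
      using simple_function_compose1[OF s(1), of norm] by (rule borel_measurable_simple_function)
    show "(\<lambda>i. norm (s i t)) \<longlonglongrightarrow> norm (g t)" if "t \<in> space M" for t
      using s(2)[OF that] by (rule tendsto_norm)
  qed
qed

lemma strongly_measurable_diff_simple:
  fixes g h :: "'a \<Rightarrow> 'b::banach"
  assumes "strongly_measurable M g" "simple_function M h"
  shows "strongly_measurable M (\<lambda>t. g t - h t)"
proof -
  from assms(1) obtain s where s: "\<And>i. simple_function M (s i)" "\<And>t. t \<in> space M \<Longrightarrow> (\<lambda>i. s i t) \<longlonglongrightarrow> g t"
    unfolding strongly_measurable_def by blast
  have "simple_function M (\<lambda>t. s i t - h t)" for i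
    using simple_function_compose2[OF s(1) assms(2), of "(-)"] .
  then show ?thesis unfolding strongly_measurable_def
    using s(2) by (intro exI[of _ "\<lambda>i t. s i t - h t"]) (auto intro!: tendsto_intros)
qed

lemma simple_function_haar_sum:
  assumes "D \<subseteq> dyadic_intervals"
  shows "simple_function unit_measure (\<lambda>t. \<Sum>I\<in>D. haar I t *\<^sub>R x I)"
proof (rule simple_function_sum)
  fix I assume "I \<in> D"
  then obtain j k where I: "I = dyadic j k" "k < 2 ^ j" using assms unfolding dyadic_intervals_eq by blast
  have ind: "simple_function unit_measure (indicator (dyadic i l) :: real \<Rightarrow> real)" if "l < 2 ^ i" for i l
  proof (rule simple_function_indicator)
    have "dyadic i l \<in> sets borel" by (simp add: dyadic_def)
    then show "dyadic i l \<in> sets unit_measure"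
      using dyadic_subset_unit[OF that] by (subst sets_restrict_space_iff) auto
  qed
  have "simple_function unit_measure (\<lambda>t. (indicator (dyadic (Suc j) (2 * k)) t - indicator (dyadic (Suc j) (2 * k + 1)) t) *\<^sub>R x I)"
    using I(2) by (intro simple_function_compose2[of _ _ _ "\<lambda>u v. (u - v) *\<^sub>R x I"] ind) auto
  then show "simple_function unit_measure (\<lambda>t. haar I t *\<^sub>R x I)"
    unfolding I(1) haar_dyadic .
qed

lemma enn_powr_mono:
  assumes "x \<le> y" "0 \<le> a"
  shows "enn_powr x a \<le> enn_powr y a"
proof (cases "y = \<top>")
  case False
  then have "x < \<top>" "y < \<top>" using assms(1) by (auto simp: less_top[symmetric] top_unique)
  then show ?thesis using assms
    by (auto simp: enn_powr_def intro!: ennreal_leI powr_mono2 enn2real_mono)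
qed (simp add: enn_powr_def)

text \<open>
  In any enumeration the partial sums are finite Haar sums with a cost below that of the whole series,
  so the inequality passes to the limit without loss in the constant.
\<close>

lemma haar_type_boundI:
  assumes p: "1 < p" and C: "0 < C"
    and node: "\<And>L (y :: nat \<Rightarrow> nat \<Rightarrow> 'b::banach).
      dyadic_mean (\<lambda>j k. norm (dyadic_sum y j k) powr p) L 0 0 \<le> C powr p * dyadic_mean (dyadic_cost p y) L 0 0"
  shows "haar_type_bound p (ennreal C) TYPE('b)"
  unfolding haar_type_bound_def
proof (intro allI impI)
  fix x :: "real set \<Rightarrow> 'b" and f
  assume "haar_sums p x f"
  then obtain e where f: "f \<in> Lp_space p unit_measure" and e: "bij_betw e (UNIV :: nat set) dyadic_intervals"
    and conv: "(\<lambda>N. Lp_norm p unit_measure (\<lambda>t. f t - (\<Sum>i<N. haar (e i) t *\<^sub>R x (e i)))) \<longlonglongrightarrow> 0"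
    by (auto simp: haar_sums_def)
  define a where "a I = norm (x I) powr p * measure lborel I" for I
  define \<sigma> where "\<sigma> = (\<Sum>\<^sub>\<infinity>I\<in>dyadic_intervals. ennreal (a I))"
  define J where "J = (\<integral>\<^sup>+t. ennreal (norm (f t) powr p) \<partial>unit_measure)"
  have a0: "0 \<le> a I" for I by (simp add: a_def)
  have J: "Lp_norm p unit_measure f = enn_powr J (1 / p)" by (simp add: Lp_norm_def J_def)
  show "Lp_norm p unit_measure f \<le> ennreal C *
      enn_powr (\<Sum>\<^sub>\<infinity>I\<in>dyadic_intervals. ennreal (norm (x I) powr p * measure lborel I)) (1 / p)"
    unfolding a_def[symmetric] \<sigma>_def[symmetric]
  proof (cases "\<sigma> = \<top>")
    case True
    then show "Lp_norm p unit_measure f \<le> ennreal C * enn_powr \<sigma> (1 / p)"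
      using C by (simp add: enn_powr_def ennreal_mult_top)
  next
    case False
    then obtain s where s: "\<sigma> = ennreal s" "0 \<le> s" by (cases \<sigma>) auto
    have "J \<noteq> \<top>" using f by (auto simp: Lp_space_def J enn_powr_def)
    then obtain r where r: "J = ennreal r" "0 \<le> r" by (cases J) auto
    have step: "r \<le> l powr (1 - p) * (C powr p * s) + (1 - l) powr (1 - p) * \<epsilon> powr p"
      if l: "0 < l" "l < 1" and \<epsilon>: "0 < \<epsilon>" for l \<epsilon> :: real
    proof -
      have "\<forall>\<^sub>F N in sequentially. Lp_norm p unit_measure (\<lambda>t. f t - (\<Sum>i<N. haar (e i) t *\<^sub>R x (e i))) < ennreal \<epsilon>"
        using order_tendstoD(2)[OF conv, of "ennreal \<epsilon>"] \<epsilon> by simp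
      then obtain N where N: "Lp_norm p unit_measure (\<lambda>t. f t - (\<Sum>i<N. haar (e i) t *\<^sub>R x (e i))) < ennreal \<epsilon>"
        by (auto simp: eventually_sequentially)
      define D where "D = e ` {..<N}"
      have D: "finite D" "D \<subseteq> dyadic_intervals" using e by (auto simp: D_def bij_betw_def)
      define S where "S t = (\<Sum>I\<in>D. haar I t *\<^sub>R x I)" for t
      have "inj_on e {..<N}" using e by (auto simp: bij_betw_def intro: inj_on_subset)
      then have S: "(\<Sum>i<N. haar (e i) t *\<^sub>R x (e i)) = S t" for t
        by (simp add: S_def D_def sum.reindex)
      have simpleS: "simple_function unit_measure S"
        unfolding S_def by (rule simple_function_haar_sum[OF D(2)])
      have smf: "strongly_measurable unit_measure f" using f by (simp add: Lp_space_def)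
      have m1: "(\<lambda>t. norm (S t)) \<in> borel_measurable unit_measure"
        using simple_function_compose1[OF simpleS, of norm] by (rule borel_measurable_simple_function)
      have m2: "(\<lambda>t. norm (f t - S t)) \<in> borel_measurable unit_measure"
        by (intro strongly_measurable_norm strongly_measurable_diff_simple smf simpleS)
      have rest: "(\<integral>\<^sup>+t. ennreal (norm (f t - S t) powr p) \<partial>unit_measure) \<le> ennreal (\<epsilon> powr p)"
      proof -
        have "(\<integral>\<^sup>+t. ennreal (norm (f t - S t) powr p) \<partial>unit_measure) =
            enn_powr (Lp_norm p unit_measure (\<lambda>t. f t - S t)) p"
          using p by (simp add: Lp_norm_def enn_powr_inverse)
        also have "\<dots> \<le> enn_powr (ennreal \<epsilon>) p"
          using N p unfolding S by (intro enn_powr_mono) auto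
        finally show ?thesis using \<epsilon> by (simp add: enn_powr_ennreal)
      qed
      have "(\<Sum>I\<in>D. ennreal (a I)) \<le> \<sigma>"
        unfolding \<sigma>_def using D by (subst nonneg_infsum_complete) (auto intro: SUP_upper)
      then have "(\<Sum>I\<in>D. a I) \<le> s" using s a0 by (simp add: sum_ennreal)
      then have part: "(\<integral>\<^sup>+t. ennreal (norm (S t) powr p) \<partial>unit_measure) \<le> ennreal (C powr p * s)"
        using finite_haar_inequality[OF node D, of x] C
        unfolding S_def a_def by (elim order_trans) (intro ennreal_leI mult_left_mono, auto)
      have "J \<le> (\<integral>\<^sup>+t. ennreal (l powr (1 - p)) * ennreal (norm (S t) powr p) +
          ennreal ((1 - l) powr (1 - p)) * ennreal (norm (f t - S t) powr p) \<partial>unit_measure)"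
        unfolding J_def
      proof (rule nn_integral_mono)
        fix t
        have "norm (f t) \<le> norm (S t) + norm (f t - S t)"
          using norm_triangle_ineq[of "S t" "f t - S t"] by simp
        then have "norm (f t) powr p \<le> (norm (S t) + norm (f t - S t)) powr p"
          using p by (intro powr_mono2) auto
        also have "\<dots> \<le> l powr (1 - p) * norm (S t) powr p + (1 - l) powr (1 - p) * norm (f t - S t) powr p"
          using l p by (intro powr_add_le_weighted) auto
        finally show "ennreal (norm (f t) powr p) \<le> ennreal (l powr (1 - p)) * ennreal (norm (S t) powr p) +
          ennreal ((1 - l) powr (1 - p)) * ennreal (norm (f t - S t) powr p)"
          by (simp add: ennreal_mult[symmetric] ennreal_plus[symmetric] ennreal_leI del: ennreal_plus)
      qed
      also have "\<dots> = ennreal (l powr (1 - p)) * (\<integral>\<^sup>+t. ennreal (norm (S t) powr p) \<partial>unit_measure) +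
          ennreal ((1 - l) powr (1 - p)) * (\<integral>\<^sup>+t. ennreal (norm (f t - S t) powr p) \<partial>unit_measure)"
        using m1 m2 by (simp add: nn_integral_add nn_integral_cmult)
      also have "\<dots> \<le> ennreal (l powr (1 - p)) * ennreal (C powr p * s) +
          ennreal ((1 - l) powr (1 - p)) * ennreal (\<epsilon> powr p)"
        by (intro add_mono mult_left_mono part rest) auto
      also have "\<dots> = ennreal (l powr (1 - p) * (C powr p * s) + (1 - l) powr (1 - p) * \<epsilon> powr p)"
        using s by (simp add: ennreal_mult[symmetric] ennreal_plus[symmetric] del: ennreal_plus)
      finally show ?thesis using s unfolding r(1) by (subst (asm) ennreal_le_iff) auto
    qed
    have step': "r \<le> l powr (1 - p) * (C powr p * s)" if l: "0 < l" "l < 1" for l :: real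
    proof (rule field_le_epsilon)
      fix \<eta> :: real assume \<eta>: "0 < \<eta>"
      \<comment> \<open>chosen to make the error term of \<open>step\<close> equal to \<open>\<eta>\<close>\<close>
      define \<epsilon> where "\<epsilon> = (\<eta> / (1 - l) powr (1 - p)) powr (1 / p)"
      have q: "0 < (1 - l) powr (1 - p)" using l by simp
      have "0 < \<epsilon>" using \<eta> l by (simp add: \<epsilon>_def)
      moreover have "\<epsilon> powr p = \<eta> / (1 - l) powr (1 - p)" using \<eta> p l by (simp add: \<epsilon>_def powr_powr)
      ultimately show "r \<le> l powr (1 - p) * (C powr p * s) + \<eta>" using step[OF l, of \<epsilon>] q by simp
    qed
    have "r \<le> C powr p * s"
    proof (rule tendsto_lowerbound)
      have "((\<lambda>l. l powr (1 - p) * (C powr p * s)) \<longlongrightarrow> 1 powr (1 - p) * (C powr p * s)) (at_left 1)"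
        by (intro tendsto_intros) auto
      then show "((\<lambda>l. l powr (1 - p) * (C powr p * s)) \<longlongrightarrow> C powr p * s) (at_left 1)" by simp
      show "\<forall>\<^sub>F l in at_left 1. r \<le> l powr (1 - p) * (C powr p * s)"
        using eventually_at_left_real[of 0 "1::real"] by (rule eventually_mono) (auto intro: step')
    qed simp
    then have "r powr (1 / p) \<le> (C powr p * s) powr (1 / p)"
      using r p by (intro powr_mono2) auto
    also have "\<dots> = C * s powr (1 / p)" using C s p by (simp add: powr_mult powr_powr)
    finally show "Lp_norm p unit_measure f \<le> ennreal C * enn_powr \<sigma> (1 / p)"
      using C r s by (simp add: J enn_powr_ennreal ennreal_mult[symmetric] ennreal_leI)
  qed
qed

section \<open>Haar type\<close>

theorem theorem2:
  fixes M :: "'a measure" and F :: "nat \<Rightarrow> 'a measure"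
    and At :: "nat \<Rightarrow> 'a set set" and ch :: "nat \<Rightarrow> 'a set \<Rightarrow> 'a set list"
    and p T :: real
  assumes "atomic_filtration M F At ch"
    and "1 < p" and "p \<le> 2"
    and "carleson_constant M (coll_E At ch) = \<infinity>"
    and "0 < T"
    and "\<And>f :: 'a \<Rightarrow> 'b::banach. f \<in> Lp_space p M \<Longrightarrow>
           Lp_norm p M f \<le> ennreal T *
             enn_powr (enn_powr (Lp_norm p M (cond_exp M (F 0) f)) p +
               (\<Sum>n. enn_powr (Lp_norm p M
                  (\<lambda>\<omega>. cond_exp M (F (Suc n)) f \<omega> - cond_exp M (F n) f \<omega>)) p)) (1 / p)"
  shows "haar_type p TYPE('b) \<and> HT p TYPE('b) \<le> ennreal (4 powr (2 / p - 1) * T)"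
proof -
  interpret atomic_filtration M F At ch by fact
  define C where "C = 4 powr (2 / p - 1) * T"
  have C: "0 < C" using assms(5) by (simp add: C_def)
  have "(2 / p - 1) * p = 2 - p" using assms(2) by (simp add: field_simps)
  then have Cp: "C powr p = T powr p * 4 powr (2 - p)"
    using assms(5) by (simp add: C_def powr_mult powr_powr)
  have "haar_type_bound p (ennreal C) TYPE('b)"
  proof (rule haar_type_boundI[OF assms(2) C])
    show "dyadic_mean (\<lambda>j k. norm (dyadic_sum y j k) powr p) L 0 0 \<le>
        C powr p * dyadic_mean (dyadic_cost p y) L 0 0" for L and y :: "nat \<Rightarrow> nat \<Rightarrow> 'b"
      unfolding Cp by (rule dyadic_inequality[OF assms(4) assms(2,3,5,6)])
  qed
  then show ?thesis
    unfolding haar_type_def HT_def C_def[symmetric]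
    by (intro conjI exI[of _ "ennreal C"] Inf_lower) auto
qed

end
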